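(* Let $\lambda=(\lambda_n)$ be an arbitrary frequency. For every bounded sequence $(f_N)_N$ in $H_\infty^\lambda[\mathrm{Re}>0]$ there are a subsequence $(f_{N_k})_k$ and $f\in H_\infty^\lambda[\mathrm{Re}>0]$ such that $f_{N_k}(\sigma+\cdot)\to f(\sigma+\cdot)$ in $H_\infty^\lambda[\mathrm{Re}>0]$ as $k\to\infty$ for every $\sigma>0$.
   Context: A frequency is a strictly increasing unbounded sequence $\lambda=(\lambda_n)_{n\ge 1}$ of non-negative real numbers. Write $[\mathrm{Re}>0]=\{s\in\mathbb{C}:\mathrm{Re}\,s>0\}$. A continuous $g:\mathbb{R}\to\mathbb{C}$ is uniformly almost periodic if for every $\varepsilon>0$ there is $\ell>0$ such that every interval $I\subset\mathbb{R}$ of length $\ell$ contains some $\tau$ with $\sup_{x\in\mathbb{R}}|g(x)-g(x+\tau)|<\varepsilon$. A function $f:[\mathrm{Re}>0]\to\mathbb{C}$ is uniformly almost periodic if $t\mapsto f(\sigma+it)$ is uniformly almost periodic for every $\sigma>0$. For $f$ bounded, holomorphic and uniformly almost periodic, its Bohr coefficients are \[ a_x(f)=\lim_{T\to\infty}\frac1{2T}\int_{-T}^T f(\sigma+it)e^{(\sigma+it)x}\,dt,\qquad x\in\mathbb{R}, \] which exist and are independent of $\sigma>0$. $H_\infty^\lambda[\mathrm{Re}>0]$ is the space of all bounded, holomorphic, uniformly almost periodic $f:[\mathrm{Re}>0]\to\mathbb{C}$ with $a_x(f)=0$ unless $x=\lambda_n$ for some $n$, with norm $\|f\|_\infty=\sup_{\mathrm{Re}\,s>0}|f(s)|$.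 The function $f(\sigma+\cdot)$ is $s\mapsto f(\sigma+s)$ on $[\mathrm{Re}>0]$. *)

theory Defs
  imports "HOL-Complex_Analysis.Complex_Analysis"
begin

(* Sequences are indexed from 0, so lam n stands for lambda_{n+1}. *)
definition frequency :: "(nat \<Rightarrow> real) \<Rightarrow> bool" where
  "frequency lam \<longleftrightarrow> strict_mono lam \<and> (\<forall>n. 0 \<le> lam n) \<and> \<not> bdd_above (range lam)"

definition right_halfplane :: "complex set" where
  "right_halfplane = {s. 0 < Re s}"

(* The supremum is taken in ereal, since a supremum of an unbounded set of reals
   would be an arbitrary real number. *)
definition uniformly_almost_periodic :: "(real \<Rightarrow> complex) \<Rightarrow> bool" where
  "uniformly_almost_periodic g \<longleftrightarrow>
     continuous_on UNIV g \<and>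
     (\<forall>\<epsilon>>0. \<exists>l>0. \<forall>a::real. \<exists>\<tau>\<in>{a..a + l}.
        (SUP x. ereal (norm (g x - g (x + \<tau>)))) < ereal \<epsilon>)"

(* Functions on the right half-plane are represented by total functions on the complex
   numbers; nothing below depends on their values outside the half-plane. *)
definition uniformly_almost_periodic_halfplane :: "(complex \<Rightarrow> complex) \<Rightarrow> bool" where
  "uniformly_almost_periodic_halfplane f \<longleftrightarrow>
     (\<forall>\<sigma>>0. uniformly_almost_periodic (\<lambda>t. f (Complex \<sigma> t)))"

definition bohr_mean :: "(complex \<Rightarrow> complex) \<Rightarrow> real \<Rightarrow> real \<Rightarrow> real \<Rightarrow> complex" where
  "bohr_mean f x \<sigma> T =
     integral {- T..T} (\<lambda>t. f (Complex \<sigma> t) * exp (Complex \<sigma> t * of_real x)) / of_real (2 * T)"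

(* The common limit of the means over all vertical lines in the half-plane. It is only used
   for bounded, holomorphic, uniformly almost periodic f, for which the limits exist and do not
   depend on sigma, so that the description is proper. *)
definition bohr_coeff :: "(complex \<Rightarrow> complex) \<Rightarrow> real \<Rightarrow> complex" where
  "bohr_coeff f x = (THE a. \<forall>\<sigma>>0. (bohr_mean f x \<sigma> \<longlongrightarrow> a) at_top)"

definition H_infty :: "(nat \<Rightarrow> real) \<Rightarrow> (complex \<Rightarrow> complex) set" where
  "H_infty lam =
     {f. bounded (f ` right_halfplane) \<and>
         f holomorphic_on right_halfplane \<and>
         uniformly_almost_periodic_halfplane f \<and>
         (\<forall>x. x \<notin> range lam \<longrightarrow> bohr_coeff f x = 0)}"

(* Only meaningful for functions that are bounded on the half-plane. *)
definition H_infty_norm :: "(complex \<Rightarrow> complex) \<Rightarrow> real" where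
  "H_infty_norm f = (SUP s\<in>right_halfplane. norm (f s))"

definition converges_in_H_infty ::
    "(nat \<Rightarrow> real) \<Rightarrow> (nat \<Rightarrow> complex \<Rightarrow> complex) \<Rightarrow> (complex \<Rightarrow> complex) \<Rightarrow> bool" where
  "converges_in_H_infty lam F f \<longleftrightarrow>
     (\<forall>k. F k \<in> H_infty lam) \<and> f \<in> H_infty lam \<and>
     (\<lambda>k. H_infty_norm (\<lambda>s. F k s - f s)) \<longlonglongrightarrow> 0"

end

theory Submission
  imports Defs "HOL-Probability.Sinc_Integral"
begin

text \<open>
  The theorem is a Montel theorem for a given frequency. The values of the functions in a bounded
  family are controlled, uniformly on every smaller half-plane \<open>Re s \<ge> \<sigma>\<close>, by finitely many of their
  Bohr coefficients; a diagonal argument on the coefficients then gives the subsequence.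

  The control comes from Riesz means. Let \<open>f\<close> be in \<open>H_infty lam\<close> with \<open>\<bar>f\<bar> \<le> C\<close>. Averaging \<open>f\<close> along
  vertical lines against the Fejer kernel of width \<open>1 / X\<close> changes it on \<open>Re s \<ge> \<sigma>\<close> by a quantity
  that tends to \<open>0\<close> as \<open>X\<close> grows and depends only on \<open>C\<close>, \<open>\<sigma>\<close> and \<open>X\<close>, because Cauchy's inequality
  makes \<open>f\<close> Lipschitz there (\<open>vertical_mean_error\<close>). The Fourier transform of the kernel has compact
  support, so the average has only the finitely many frequencies \<open>lam n < X\<close>, and it is in fact the
  Dirichlet polynomial with the corresponding damped coefficients
  (\<open>vertical_mean_eq_dirichlet_polynomial\<close>). If the coefficients of a bounded sequence converge one by
  one, these polynomials converge uniformly for each \<open>X\<close>, so the sequence itself is uniformly Cauchy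
  on \<open>Re s \<ge> \<sigma>\<close> (\<open>uniformly_Cauchy_if_coefficients_converge\<close>), and its limit stays in the space
  (\<open>H_infty_uniform_limit\<close>).

  Identifying the average with the polynomial requires the uniqueness theorem of Bohr: an almost
  periodic function all of whose Fourier coefficients vanish is zero
  (\<open>almost_periodic_eq_0_if_means_0\<close>). The proof given here is elementary. Total boundedness of the
  translates provides, by the pigeonhole principle, a set \<open>I\<close> of positive density of grid points whose
  translates nearly coincide. The sum of \<open>v (t\<^sub>0 + h (j - i))\<close> over \<open>i\<close> and \<open>j\<close> in \<open>I\<close> is then almost
  \<open>(card I)\<^sup>2 v t\<^sub>0\<close>; but it is a Toeplitz form, hence bounded by \<open>card I\<close> times the largest exponential
  sum of the samples, and all these sums are small since the Fourier coefficients vanish.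
\<close>

section \<open>Almost periodic functions on the line\<close>

text \<open>Bochner's form of almost periodicity: the translates of the function are totally bounded in
  the supremum norm. It is equivalent to Bohr's form by relatively dense almost periods, but unlike
  that form it passes to sums and products without any work on common almost periods, and the
  pigeonhole argument for the uniqueness theorem needs exactly such a finite net of translates.\<close>

definition almost_periodic :: "(real \<Rightarrow> complex) \<Rightarrow> bool" where
  "almost_periodic g \<longleftrightarrow> continuous_on UNIV g \<and>
     (\<forall>\<epsilon>>0. \<exists>A. finite A \<and> (\<forall>a. \<exists>b\<in>A. \<forall>x. norm (g (x + a) - g (x + b)) \<le> \<epsilon>))"

lemma almost_periodic_continuous: "almost_periodic g \<Longrightarrow> continuous_on S g"
  unfolding almost_periodic_def by (meson continuous_on_subset subset_UNIV)

lemma almost_periodic_net: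
  assumes "almost_periodic g" "\<epsilon> > 0"
  obtains A where "finite A" "\<And>a. \<exists>b\<in>A. \<forall>x. norm (g (x + a) - g (x + b)) \<le> \<epsilon>"
  using assms unfolding almost_periodic_def by metis

lemma uniformly_almost_periodic_bound:
  assumes "uniformly_almost_periodic g" "\<epsilon> > 0"
  obtains l where "l > 0" "\<And>a. \<exists>\<tau>\<in>{a..a + l}. \<forall>x. norm (g x - g (x + \<tau>)) < \<epsilon>"
proof -
  obtain l where "l > 0"
    and l: "\<And>a::real. \<exists>\<tau>\<in>{a..a + l}. (SUP x. ereal (norm (g x - g (x + \<tau>)))) < ereal \<epsilon>"
    using assms unfolding uniformly_almost_periodic_def by metis
  show thesis
  proof (rule that[OF \<open>l > 0\<close>])
    fix a
    obtain \<tau> where \<tau>: "\<tau> \<in> {a..a + l}" "(SUP x. ereal (norm (g x - g (x + \<tau>)))) < ereal \<epsilon>"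
      using l by blast
    have "norm (g x - g (x + \<tau>)) < \<epsilon>" for x
    proof -
      have "ereal (norm (g x - g (x + \<tau>))) \<le> (SUP x. ereal (norm (g x - g (x + \<tau>))))"
        by (rule SUP_upper) simp
      then show ?thesis
        using \<tau>(2) by (metis ereal_less_eq(3) le_less_trans less_ereal.simps(1))
    qed
    then show "\<exists>\<tau>\<in>{a..a + l}. \<forall>x. norm (g x - g (x + \<tau>)) < \<epsilon>"
      using \<tau>(1) by blast
  qed
qed

text \<open>An almost period moves any two nearby points into one fixed compact interval, where the function
  is uniformly continuous.\<close>

lemma uniformly_almost_periodic_uniformly_continuous:
  assumes "uniformly_almost_periodic g"
  shows "uniformly_continuous_on UNIV g"
  unfolding uniformly_continuous_on_def
proof (intro allI impI)
  fix e :: real assume "e > 0"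
  then obtain l where "l > 0"
    and l: "\<And>a. \<exists>\<tau>\<in>{a..a + l}. \<forall>x. norm (g x - g (x + \<tau>)) < e / 3"
    using uniformly_almost_periodic_bound[OF assms, of "e / 3"] by auto
  have "uniformly_continuous_on {-1..l + 1} g"
    using assms by (intro compact_uniformly_continuous)
      (auto simp: uniformly_almost_periodic_def intro: continuous_on_subset)
  then obtain d where "d > 0"
    and d: "\<And>x y. x \<in> {-1..l+1} \<Longrightarrow> y \<in> {-1..l+1} \<Longrightarrow> dist y x < d \<Longrightarrow> dist (g y) (g x) < e / 3"
    using \<open>e > 0\<close> unfolding uniformly_continuous_on_def by (metis divide_pos_pos zero_less_numeral)
  show "\<exists>d>0. \<forall>x\<in>UNIV. \<forall>y\<in>UNIV. dist y x < d \<longrightarrow> dist (g y) (g x) < e"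
  proof (intro exI[of _ "min d 1"] conjI ballI impI)
    fix x y :: real assume xy: "dist y x < min d 1"
    obtain \<tau> where \<tau>: "\<tau> \<in> {-x..-x + l}" "\<And>z. norm (g z - g (z + \<tau>)) < e / 3"
      using l by blast
    have "dist (g (y + \<tau>)) (g (x + \<tau>)) < e / 3"
      using xy \<tau>(1) by (intro d) (auto simp: dist_real_def abs_if split: if_splits)
    moreover have "dist (g y) (g (y + \<tau>)) < e / 3" "dist (g (x + \<tau>)) (g x) < e / 3"
      using \<tau>(2)[of y] \<tau>(2)[of x] by (simp_all add: dist_norm norm_minus_commute)
    ultimately show "dist (g y) (g x) < e"
      using dist_triangle[of "g y" "g x" "g (y + \<tau>)"] dist_triangle[of "g (y + \<tau>)" "g x" "g (x + \<tau>)"]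
      by linarith
  qed (use \<open>d > 0\<close> in auto)
qed

text \<open>From Bohr to Bochner: every translate is close to a translate by an amount in one window
  \<open>{0..l}\<close>, and uniform continuity thins that window out to a finite grid. From Bochner to Bohr: if the
  translate by \<open>a + L\<close> is close to the translate by \<open>b\<close> from the net, then \<open>a + L - b\<close> is an almost
  period, and it lies in a window about \<open>a + L\<close> whose radius \<open>L\<close> bounds the whole net.\<close>

lemma uniformly_almost_periodic_iff: "uniformly_almost_periodic g \<longleftrightarrow> almost_periodic g"
proof
  assume g: "uniformly_almost_periodic g"
  show "almost_periodic g"
    unfolding almost_periodic_def
  proof (intro conjI allI impI)
    show "continuous_on UNIV g"
      using g by (simp add: uniformly_almost_periodic_def)
    fix e :: real assume "e > 0"
    then obtain l where "l > 0"
      and l: "\<And>a. \<exists>\<tau>\<in>{a..a + l}. \<forall>x. norm (g x - g (x + \<tau>)) < e / 2"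
      using uniformly_almost_periodic_bound[OF g, of "e / 2"] by auto
    obtain d where "d > 0" and d: "\<And>x y. dist y x < d \<Longrightarrow> dist (g y) (g x) < e / 2"
      using uniformly_almost_periodic_uniformly_continuous[OF g] \<open>e > 0\<close>
      unfolding uniformly_continuous_on_def by (metis UNIV_I half_gt_zero)
    \<comment> \<open>a finite grid of mesh below d in a window of length l\<close>
    obtain A where A: "finite A" "A \<subseteq> {0..l}" "{0..l} \<subseteq> (\<Union>b\<in>A. ball b d)"
    proof (rule compactE_image[of "{0..l}" "{0..l}" "\<lambda>b. ball b d"])
      show "{0..l} \<subseteq> (\<Union>b\<in>{0..l}. ball b d)" using \<open>d > 0\<close> by force
    qed auto
    have "\<exists>b\<in>A. \<forall>x. norm (g (x + a) - g (x + b)) \<le> e" for a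
    proof -
      obtain \<tau> where \<tau>: "\<tau> \<in> {-a..-a + l}" "\<And>z. norm (g z - g (z + \<tau>)) < e / 2"
        using l by blast
      then have "a + \<tau> \<in> {0..l}" by auto
      then obtain b where b: "b \<in> A" "dist b (a + \<tau>) < d"
        using A(3) by auto
      have "norm (g (x + a) - g (x + b)) \<le> e" for x
      proof -
        have "dist (g (x + a)) (g (x + a + \<tau>)) < e / 2"
          using \<tau>(2)[of "x + a"] by (simp add: dist_norm)
        moreover have "dist (g (x + a + \<tau>)) (g (x + b)) < e / 2"
          using b(2) by (intro d) (simp add: dist_real_def)
        ultimately have "dist (g (x + a)) (g (x + b)) < e"
          using dist_triangle[of "g (x + a)" "g (x + b)" "g (x + a + \<tau>)"] by linarith
        then show ?thesis by (simp add: dist_norm)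
      qed
      then show ?thesis using b(1) by blast
    qed
    then show "\<exists>A. finite A \<and> (\<forall>a. \<exists>b\<in>A. \<forall>x. norm (g (x + a) - g (x + b)) \<le> e)"
      using A(1) by blast
  qed
next
  assume g: "almost_periodic g"
  show "uniformly_almost_periodic g"
    unfolding uniformly_almost_periodic_def
  proof (intro conjI allI impI)
    show "continuous_on UNIV g" using g by (rule almost_periodic_continuous)
    fix e :: real assume "e > 0"
    then obtain A where "finite A" and A: "\<And>a. \<exists>b\<in>A. \<forall>x. norm (g (x + a) - g (x + b)) \<le> e / 2"
      using almost_periodic_net[OF g, of "e / 2"] by auto
    obtain L where L: "\<And>b. b \<in> A \<Longrightarrow> \<bar>b\<bar> \<le> L" "L > 0"
      using finite_imp_bounded[OF \<open>finite A\<close>] unfolding bounded_pos real_norm_def by blast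
    have "\<exists>\<tau>\<in>{a..a + 2 * L}. (SUP x. ereal (norm (g x - g (x + \<tau>)))) < ereal e" for a
    proof -
      obtain b where b: "b \<in> A" "\<And>x. norm (g (x + (a + L)) - g (x + b)) \<le> e / 2"
        using A by blast
      have "norm (g x - g (x + (a + L - b))) \<le> e / 2" for x
        using b(2)[of "x - b"] by (simp add: algebra_simps norm_minus_commute)
      then have "(SUP x. ereal (norm (g x - g (x + (a + L - b))))) \<le> ereal (e / 2)"
        by (intro SUP_least) simp
      also have "\<dots> < ereal e" using \<open>e > 0\<close> by simp
      finally show ?thesis
        using L(1)[OF b(1)] by (intro bexI[of _ "a + L - b"]) auto
    qed
    then show "\<exists>l>0. \<forall>a::real. \<exists>\<tau>\<in>{a..a + l}. (SUP x. ereal (norm (g x - g (x + \<tau>)))) < ereal e"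
      using \<open>L > 0\<close> by (intro exI[of _ "2 * L"]) auto
  qed
qed

lemma almost_periodic_uniformly_continuous: "almost_periodic g \<Longrightarrow> uniformly_continuous_on UNIV g"
  using uniformly_almost_periodic_uniformly_continuous uniformly_almost_periodic_iff by blast

lemma almost_periodic_bounded:
  assumes "almost_periodic g"
  obtains C where "C > 0" "\<And>x. norm (g x) \<le> C"
proof -
  obtain A where A: "finite A" "\<And>a. \<exists>b\<in>A. \<forall>x. norm (g (x + a) - g (x + b)) \<le> 1"
    using almost_periodic_net[OF assms, of 1] by auto
  obtain C where C: "\<And>b. b \<in> A \<Longrightarrow> norm (g b) \<le> C" "C > 0"
    using finite_imp_bounded[OF finite_imageI[OF A(1)], of g] unfolding bounded_pos by blast
  show thesis
  proof (rule that[of "C + 1"])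
    fix x
    obtain b where b: "b \<in> A" "norm (g x - g b) \<le> 1"
      using A(2)[of x] by (metis add_0)
    then show "norm (g x) \<le> C + 1"
      using C(1)[OF b(1)] norm_triangle_sub[of "g x" "g b"] by linarith
  qed (use C in auto)
qed

text \<open>Pairs of net points, one for each function, sort all translations into finitely many classes;
  one representative of each nonempty class serves both functions at once.\<close>

lemma almost_periodic_common_net:
  assumes "almost_periodic f" "almost_periodic g" "\<epsilon> > 0"
  obtains A where "finite A"
    "\<And>a. \<exists>b\<in>A. \<forall>x. norm (f (x + a) - f (x + b)) \<le> \<epsilon> \<and> norm (g (x + a) - g (x + b)) \<le> \<epsilon>"
proof -
  obtain B where B: "finite B" "\<And>a. \<exists>b\<in>B. \<forall>x. norm (f (x + a) - f (x + b)) \<le> \<epsilon> / 2"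
    using almost_periodic_net[OF assms(1), of "\<epsilon> / 2"] assms(3) by auto
  obtain D where D: "finite D" "\<And>a. \<exists>b\<in>D. \<forall>x. norm (g (x + a) - g (x + b)) \<le> \<epsilon> / 2"
    using almost_periodic_net[OF assms(2), of "\<epsilon> / 2"] assms(3) by auto
  define P where "P = (\<lambda>(b, d) a. (\<forall>x. norm (f (x + a) - f (x + b)) \<le> \<epsilon> / 2) \<and>
                                   (\<forall>x. norm (g (x + a) - g (x + d)) \<le> \<epsilon> / 2))"
  define A where "A = (\<lambda>p. SOME a. P p a) ` (B \<times> D)"
  show thesis
  proof (rule that[of A])
    show "finite A" using B(1) D(1) by (simp add: A_def)
    fix a
    obtain b d where bd: "b \<in> B" "d \<in> D" and a: "P (b, d) a"
      using B(2)[of a] D(2)[of a] unfolding P_def by auto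
    define c where "c = (SOME a. P (b, d) a)"
    have c: "P (b, d) c" unfolding c_def using a by (rule someI[where P = "P (b, d)"])
    have "norm (f (x + a) - f (x + c)) \<le> \<epsilon> \<and> norm (g (x + a) - g (x + c)) \<le> \<epsilon>" for x
    proof -
      have "norm (f (x + a) - f (x + c)) \<le> norm (f (x + a) - f (x + b)) + norm (f (x + c) - f (x + b))"
           "norm (g (x + a) - g (x + c)) \<le> norm (g (x + a) - g (x + d)) + norm (g (x + c) - g (x + d))"
        using dist_triangle2[of "f (x + a)" "f (x + c)" "f (x + b)"]
              dist_triangle2[of "g (x + a)" "g (x + c)" "g (x + d)"]
        by (simp_all add: dist_norm)
      moreover have "norm (f (x + a) - f (x + b)) \<le> \<epsilon> / 2" "norm (f (x + c) - f (x + b)) \<le> \<epsilon> / 2"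
        "norm (g (x + a) - g (x + d)) \<le> \<epsilon> / 2" "norm (g (x + c) - g (x + d)) \<le> \<epsilon> / 2"
        using a c unfolding P_def by auto
      ultimately show ?thesis by linarith
    qed
    then show "\<exists>b\<in>A. \<forall>x. norm (f (x + a) - f (x + b)) \<le> \<epsilon> \<and> norm (g (x + a) - g (x + b)) \<le> \<epsilon>"
      using bd unfolding A_def c_def by blast
  qed
qed

lemma almost_periodic_diff:
  assumes "almost_periodic f" "almost_periodic g" shows "almost_periodic (\<lambda>x. f x - g x)"
  unfolding almost_periodic_def
proof (intro conjI allI impI)
  show "continuous_on UNIV (\<lambda>x. f x - g x)"
    using assms by (intro continuous_intros almost_periodic_continuous)
  fix e :: real assume "e > 0"
  then obtain A where A: "finite A" "\<And>a. \<exists>b\<in>A. \<forall>x. norm (f (x + a) - f (x + b)) \<le> e / 2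
      \<and> norm (g (x + a) - g (x + b)) \<le> e / 2"
    using almost_periodic_common_net[OF assms, of "e / 2"] by auto
  have "\<exists>b\<in>A. \<forall>x. norm (f (x + a) - g (x + a) - (f (x + b) - g (x + b))) \<le> e" for a
  proof -
    obtain b where b: "b \<in> A" "\<And>x. norm (f (x + a) - f (x + b)) \<le> e / 2" "\<And>x. norm (g (x + a) - g (x + b)) \<le> e / 2"
      using A(2) by meson
    have "norm (f (x + a) - g (x + a) - (f (x + b) - g (x + b))) \<le> e" for x
      using b(2,3)[of x] norm_triangle_ineq4[of "f (x + a) - f (x + b)" "g (x + a) - g (x + b)"]
      by (simp add: algebra_simps)
    then show ?thesis using b(1) by blast
  qed
  then show "\<exists>A. finite A \<and> (\<forall>a. \<exists>b\<in>A. \<forall>x. norm (f (x + a) - g (x + a) - (f (x + b) - g (x + b))) \<le> e)"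
    using A(1) by blast
qed

lemma almost_periodic_mult:
  assumes "almost_periodic f" "almost_periodic g" shows "almost_periodic (\<lambda>x. f x * g x)"
  unfolding almost_periodic_def
proof (intro conjI allI impI)
  show "continuous_on UNIV (\<lambda>x. f x * g x)"
    using assms by (intro continuous_intros almost_periodic_continuous)
  obtain C where C: "C > 0" "\<And>x. norm (f x) \<le> C" using almost_periodic_bounded[OF assms(1)] by blast
  obtain D where D: "D > 0" "\<And>x. norm (g x) \<le> D" using almost_periodic_bounded[OF assms(2)] by blast
  fix e :: real assume "e > 0"
  then have "e / (C + D) > 0" using C D by simp
  then obtain A where A: "finite A" "\<And>a. \<exists>b\<in>A. \<forall>x. norm (f (x + a) - f (x + b)) \<le> e / (C + D)
      \<and> norm (g (x + a) - g (x + b)) \<le> e / (C + D)"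
    using almost_periodic_common_net[OF assms \<open>e / (C + D) > 0\<close>] by blast
  have "\<exists>b\<in>A. \<forall>x. norm (f (x + a) * g (x + a) - f (x + b) * g (x + b)) \<le> e" for a
  proof -
    obtain b where b: "b \<in> A" "\<And>x. norm (f (x + a) - f (x + b)) \<le> e / (C + D)"
        "\<And>x. norm (g (x + a) - g (x + b)) \<le> e / (C + D)"
      using A(2) by meson
    have "norm (f (x + a) * g (x + a) - f (x + b) * g (x + b)) \<le> e" for x
    proof -
      have "f (x + a) * g (x + a) - f (x + b) * g (x + b)
          = f (x + a) * (g (x + a) - g (x + b)) + (f (x + a) - f (x + b)) * g (x + b)"
        by (simp add: algebra_simps)
      also have "norm \<dots> \<le> C * (e / (C + D)) + (e / (C + D)) * D"
        unfolding norm_mult using C D b(2,3) \<open>e > 0\<close>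
        by (intro norm_triangle_mono norm_mult[THEN eq_refl, THEN order_trans] mult_mono) auto
      also have "\<dots> = (C + D) * (e / (C + D))"
        by (simp only: distrib_right mult.commute[of _ D])
      also have "\<dots> = e" using C(1) D(1) by simp
      finally show ?thesis .
    qed
    then show ?thesis using b(1) by blast
  qed
  then show "\<exists>A. finite A \<and> (\<forall>a. \<exists>b\<in>A. \<forall>x. norm (f (x + a) * g (x + a) - f (x + b) * g (x + b)) \<le> e)"
    using A(1) by blast
qed

lemma almost_periodic_const: "almost_periodic (\<lambda>x. c)"
  unfolding almost_periodic_def by (auto intro!: exI[of _ "{0::real}"])

lemma almost_periodic_sum:
  assumes "\<And>i. i \<in> I \<Longrightarrow> almost_periodic (f i)" shows "almost_periodic (\<lambda>x. \<Sum>i\<in>I. f i x)"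
  using assms
proof (induction I rule: infinite_finite_induct)
  case (insert i I)
  have "almost_periodic (\<lambda>x. f i x - (0 - (\<Sum>i\<in>I. f i x)))"
    using insert by (intro almost_periodic_diff almost_periodic_const) auto
  then show ?case using insert.hyps by simp
qed (simp_all add: almost_periodic_const)

lemma almost_periodic_cis: "almost_periodic (\<lambda>t. cis (x * t))"
proof -
  have "uniformly_almost_periodic (\<lambda>t. cis (x * t))"
    unfolding uniformly_almost_periodic_def
  proof (intro conjI allI impI)
    show "continuous_on UNIV (\<lambda>t. cis (x * t))" by (intro continuous_intros)
    fix e :: real assume "e > 0"
    \<comment> \<open>every window of length one period contains a multiple of the period\<close>
    define p where "p = (if x = 0 then 1 else 2 * pi / \<bar>x\<bar>)"
    have "p > 0" by (simp add: p_def)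
    have "\<exists>\<tau>\<in>{a..a + p}. (SUP t. ereal (norm (cis (x * t) - cis (x * (t + \<tau>))))) < ereal e" for a
    proof (intro bexI[of _ "p * of_int \<lceil>a / p\<rceil>"])
      have "cis (x * (p * of_int \<lceil>a / p\<rceil>)) = 1"
      proof (cases "x = 0")
        case False
        then have "x * (p * of_int \<lceil>a / p\<rceil>) = 2 * pi * of_int (\<lceil>a / p\<rceil> * (if x > 0 then 1 else -1))"
          by (auto simp: p_def abs_if)
        then show ?thesis by (simp only: cis_multiple_2pi Ints_of_int)
      qed simp
      then have "cis (x * (t + p * of_int \<lceil>a / p\<rceil>)) = cis (x * t)" for t
        by (simp add: distrib_left cis_mult[symmetric])
      then show "(SUP t. ereal (norm (cis (x * t) - cis (x * (t + p * of_int \<lceil>a / p\<rceil>))))) < ereal e"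
        using \<open>e > 0\<close> by simp
      have "a / p \<le> of_int \<lceil>a / p\<rceil>" "of_int \<lceil>a / p\<rceil> \<le> a / p + 1" by linarith+
      then have "p * (a / p) \<le> p * of_int \<lceil>a / p\<rceil>" "p * of_int \<lceil>a / p\<rceil> \<le> p * (a / p + 1)"
        using \<open>p > 0\<close> by (auto intro!: mult_left_mono simp del: times_divide_eq_right)
      then show "p * of_int \<lceil>a / p\<rceil> \<in> {a..a + p}"
        using \<open>p > 0\<close> by (simp add: distrib_left)
    qed
    then show "\<exists>l>0. \<forall>a::real. \<exists>\<tau>\<in>{a..a + l}.
        (SUP t. ereal (norm (cis (x * t) - cis (x * (t + \<tau>))))) < ereal e"
      using \<open>p > 0\<close> by blast
  qed
  then show ?thesis by (simp add: uniformly_almost_periodic_iff)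
qed

lemma almost_periodic_uniform_limit:
  assumes "\<And>n::nat. almost_periodic (f n)" "uniform_limit UNIV f g sequentially"
  shows "almost_periodic g"
  unfolding almost_periodic_def
proof (intro conjI allI impI)
  show "continuous_on UNIV g"
    using assms by (intro uniform_limit_theorem[OF _ assms(2)]) (auto intro!: always_eventually almost_periodic_continuous)
  fix e :: real assume "e > 0"
  then obtain n where n: "\<And>x. dist (f n x) (g x) < e / 3"
    using uniform_limitD[OF assms(2), of "e / 3"] by (auto simp: eventually_sequentially)
  obtain A where A: "finite A" "\<And>a. \<exists>b\<in>A. \<forall>x. norm (f n (x + a) - f n (x + b)) \<le> e / 3"
    using almost_periodic_net[OF assms(1)[of n], of "e / 3"] \<open>e > 0\<close> by auto
  have "\<exists>b\<in>A. \<forall>x. norm (g (x + a) - g (x + b)) \<le> e" for a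
  proof -
    obtain b where b: "b \<in> A" "\<And>x. dist (f n (x + a)) (f n (x + b)) \<le> e / 3"
      using A(2) unfolding dist_norm by meson
    have "dist (g (x + a)) (g (x + b)) \<le> e" for x
      using b(2)[of x] n[of "x + a"] n[of "x + b"]
        dist_triangle[of "g (x + a)" "g (x + b)" "f n (x + a)"]
        dist_triangle[of "f n (x + a)" "g (x + b)" "f n (x + b)"]
      by (simp add: dist_commute)
    then show ?thesis using b(1) by (auto simp: dist_norm)
  qed
  then show "\<exists>A. finite A \<and> (\<forall>a. \<exists>b\<in>A. \<forall>x. norm (g (x + a) - g (x + b)) \<le> e)"
    using A(1) by blast
qed

section \<open>Mean values\<close>

text \<open>The convergence is demanded uniformly over the position of the window. For almost periodic
  functions this is automatic, and it makes translation invariance of the mean evident.\<close>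

definition has_mean :: "(real \<Rightarrow> complex) \<Rightarrow> complex \<Rightarrow> bool" where
  "has_mean g m \<longleftrightarrow>
     (\<forall>\<epsilon>>0. \<exists>T\<^sub>0>0. \<forall>T\<ge>T\<^sub>0. \<forall>a. norm (integral {a..a + T} g - of_real T * m) \<le> \<epsilon> * T)"

lemma window_shift:
  fixes g :: "real \<Rightarrow> complex"
  assumes "continuous_on UNIV g"
  shows "integral {a..b} (\<lambda>t. g (t + c)) = integral {a + c..b + c} g"
  using integral_shift[of a c b g] continuous_on_subset[OF assms] by (simp add: o_def)

lemma window_bound:
  fixes g :: "real \<Rightarrow> complex"
  assumes "continuous_on UNIV g" "\<And>t. norm (g t) \<le> C" "a \<le> b"
  shows "norm (integral {a..b} g) \<le> C * (b - a)"
  using assms by (intro integral_bound) (auto intro: continuous_on_subset)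

lemma window_integrable:
  fixes g :: "real \<Rightarrow> complex"
  assumes "continuous_on UNIV g" shows "g integrable_on {a..b}"
  using assms by (intro integrable_continuous_real) (auto intro: continuous_on_subset)

lemma window_combine:
  fixes g :: "real \<Rightarrow> complex"
  assumes "continuous_on UNIV g" "p \<le> q" "q \<le> r"
  shows "integral {p..r} g = integral {p..q} g + integral {q..r} g"
  using Henstock_Kurzweil_Integration.integral_combine[OF assms(2,3) window_integrable[OF assms(1)]] by simp

text \<open>Long windows are cut into windows of the fixed length \<open>L\<close>, so a bound that is uniform over the
  position at one length gives a bound at every larger length.\<close>

lemma window_split:
  fixes g :: "real \<Rightarrow> complex"
  assumes g: "continuous_on UNIV g" "\<And>t. norm (g t) \<le> C"
    and L: "L > 0" "\<And>a. norm (integral {a..a + L} g) \<le> B" and T: "T \<ge> 0"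
  shows "norm (integral {a..a + T} g) \<le> T / L * B + C * L"
proof -
  have B: "B \<ge> 0" using L(2)[of 0] norm_ge_zero order_trans by blast
  have C: "C \<ge> 0" using g(2)[of 0] norm_ge_zero order_trans by blast
  have whole: "norm (integral {a..a + real n * L} g) \<le> real n * B" for n
  proof (induction n)
    case (Suc n)
    have "integral {a..a + real (Suc n) * L} g
        = integral {a..a + real n * L} g + integral {a + real n * L..a + real n * L + L} g"
      using L(1) window_combine[OF g(1), of a "a + real n * L" "a + real n * L + L"]
      by (simp add: algebra_simps)
    also have "norm \<dots> \<le> real n * B + B"
      by (intro norm_triangle_mono Suc L(2))
    finally show ?case by (simp add: algebra_simps)
  qed simp
  define n where "n = nat \<lfloor>T / L\<rfloor>"
  have "real n \<le> T / L" "T / L \<le> real n + 1"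
    using T L(1) by (simp_all add: n_def)
  then have n: "real n * L \<le> T" "T \<le> real n * L + L"
    using L(1) by (simp_all add: field_simps)
  have "integral {a..a + T} g = integral {a..a + real n * L} g + integral {a + real n * L..a + T} g"
    using L(1) n by (intro window_combine[OF g(1)]) auto
  also have "norm \<dots> \<le> real n * B + C * (a + T - (a + real n * L))"
    using n by (intro norm_triangle_mono whole window_bound g) auto
  also have "\<dots> \<le> T / L * B + C * L"
    using n \<open>real n \<le> T / L\<close> B C by (intro add_mono mult_right_mono mult_left_mono) auto
  finally show ?thesis .
qed

lemma window_translation:
  fixes g :: "real \<Rightarrow> complex"
  assumes g: "continuous_on UNIV g" "\<And>t. norm (g t) \<le> C" and T: "T \<ge> 0"
  shows "norm (integral {b..b + T} g - integral {0..T} g) \<le> 2 * C * \<bar>b\<bar>"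
proof -
  have C: "C \<ge> 0" using g(2)[of 0] norm_ge_zero order_trans by blast
  have *: "integral {p..r} g = integral {p..q} g + integral {q..r} g" if "p \<le> q" "q \<le> r" for p q r
    using that by (rule window_combine[OF g(1)])
  have "integral {b..b + T} g - integral {0..T} g
      = (if b \<ge> 0 then integral {T..b + T} g - integral {0..b} g
         else integral {b..0} g - integral {b + T..T} g)"
    using *[of 0 b "b + T"] *[of 0 T "b + T"] *[of b 0 T] *[of b "b + T" T] T
    by (auto simp: algebra_simps)
  also have "norm \<dots> \<le> C * \<bar>b\<bar> + C * \<bar>b\<bar>"
    using window_bound[OF g, of T "b + T"] window_bound[OF g, of 0 b]
      window_bound[OF g, of b 0] window_bound[OF g, of "b + T" T]
    by (auto split: if_splits intro!: order_trans[OF norm_triangle_ineq4] add_mono)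
  finally show ?thesis by simp
qed

text \<open>The window at \<open>a\<close> can be replaced by the window at a point \<open>b\<close> of a finite net at a cost
  proportional to \<open>T\<close>; moving from \<open>b\<close> to \<open>0\<close> then costs an amount that does not grow with \<open>T\<close>.\<close>

lemma almost_periodic_window_integrals_agree:
  assumes g: "almost_periodic g" and "\<epsilon> > 0"
  obtains T\<^sub>0 where "T\<^sub>0 > 0"
    "\<And>T a. T \<ge> T\<^sub>0 \<Longrightarrow> norm (integral {a..a + T} g - integral {0..T} g) \<le> \<epsilon> * T"
proof -
  note cont = almost_periodic_continuous[OF g]
  obtain C where C: "C > 0" "\<And>x. norm (g x) \<le> C" using almost_periodic_bounded[OF g] by blast
  obtain A where A: "finite A" "\<And>a. \<exists>b\<in>A. \<forall>x. norm (g (x + a) - g (x + b)) \<le> \<epsilon> / 2"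
    using almost_periodic_net[OF g, of "\<epsilon> / 2"] \<open>\<epsilon> > 0\<close> by auto
  obtain L where L: "\<And>b. b \<in> A \<Longrightarrow> \<bar>b\<bar> \<le> L" "L > 0"
    using finite_imp_bounded[OF A(1)] unfolding bounded_pos real_norm_def by blast
  show thesis
  proof (rule that[of "4 * C * L / \<epsilon>"])
    show "4 * C * L / \<epsilon> > 0" using C L \<open>\<epsilon> > 0\<close> by simp
    fix T a assume T: "T \<ge> 4 * C * L / \<epsilon>"
    then have "T > 0" using \<open>4 * C * L / \<epsilon> > 0\<close> by linarith
    obtain b where b: "b \<in> A" "\<And>x. norm (g (x + a) - g (x + b)) \<le> \<epsilon> / 2" using A(2) by blast
    have "integral {a..a + T} g - integral {b..b + T} g
        = integral {0..T} (\<lambda>t. g (t + a)) - integral {0..T} (\<lambda>t. g (t + b))"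
      by (simp add: window_shift[OF cont] add.commute)
    also have "\<dots> = integral {0..T} (\<lambda>t. g (t + a) - g (t + b))"
      by (intro Henstock_Kurzweil_Integration.integral_diff[symmetric] window_integrable
          continuous_on_compose2[OF cont]) (auto intro!: continuous_intros)
    also have "norm \<dots> \<le> \<epsilon> / 2 * (T - 0)"
      using \<open>T > 0\<close> b(2)
      by (intro window_bound) (auto intro!: continuous_intros continuous_on_compose2[OF cont])
    finally have 1: "norm (integral {a..a + T} g - integral {b..b + T} g) \<le> \<epsilon> / 2 * T" by simp
    have "norm (integral {b..b + T} g - integral {0..T} g) \<le> 2 * C * \<bar>b\<bar>"
      using \<open>T > 0\<close> by (intro window_translation cont C) auto
    also have "\<dots> \<le> 2 * C * L" using C L(1)[OF b(1)] by simp
    also have "\<dots> \<le> \<epsilon> / 2 * T" using T \<open>\<epsilon> > 0\<close> by (simp add: field_simps)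
    finally show "norm (integral {a..a + T} g - integral {0..T} g) \<le> \<epsilon> * T"
      using 1 norm_diff_triangle_ineq[of "integral {a..a + T} g" "integral {b..b + T} g"]
      by (smt (verit, best) add_diff_cancel_right' diff_add_cancel field_sum_of_halves norm_diff_triangle_le distrib_right)
  qed
qed

text \<open>The average \<open>z k\<close> over a suitable window of length \<open>L k\<close> is, up to \<open>1 / (k + 1)\<close>, the average over
  every window of that length, hence asymptotically over all longer windows. Two such approximate
  means can be compared on one very long window, so they form a Cauchy sequence.\<close>

lemma almost_periodic_has_mean:
  assumes g: "almost_periodic g" obtains m where "has_mean g m"
proof -
  note cont = almost_periodic_continuous[OF g]
  obtain C where C: "C > 0" "\<And>x. norm (g x) \<le> C" using almost_periodic_bounded[OF g] by blast
  have "\<exists>T>0. \<forall>a. norm (integral {a..a + T} g - integral {0..T} g) \<le> 1 / real (Suc k) * T" for k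
    using almost_periodic_window_integrals_agree[OF g, of "1 / real (Suc k)"] by (metis of_nat_0_less_iff order_refl zero_less_Suc zero_less_divide_1_iff)
  then obtain L where L: "\<And>k. L k > 0"
    "\<And>k a. norm (integral {a..a + L k} g - integral {0..L k} g) \<le> 1 / real (Suc k) * L k"
    by metis
  define z where "z = (\<lambda>k. integral {0..L k} g / of_real (L k))"
  have z_bound: "norm (z k) \<le> C" for k
    using window_bound[OF cont C(2), of 0 "L k"] L(1)[of k] by (simp add: z_def norm_divide field_simps)
  have int: "integral {a..a + T} (\<lambda>t. g t - c) = integral {a..a + T} g - of_real T * c" if "T \<ge> 0" for a T c
    using that Henstock_Kurzweil_Integration.integral_diff[OF window_integrable[OF cont] integrable_const_ivl, of a "a + T" c]
    by (simp add: scaleR_conv_of_real)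
  have key: "norm (integral {a..a + T} g - of_real T * z k) \<le> T / real (Suc k) + 2 * C * L k"
    if "T \<ge> 0" for a T k
  proof -
    have "norm (integral {a..a + T} (\<lambda>t. g t - z k)) \<le> T / L k * (1 / real (Suc k) * L k) + (2 * C) * L k"
    proof (rule window_split)
      show "norm (g t - z k) \<le> 2 * C" for t
        using norm_triangle_ineq4[of "g t" "z k"] C(2)[of t] z_bound[of k] by linarith
      show "norm (integral {a..a + L k} (\<lambda>t. g t - z k)) \<le> 1 / real (Suc k) * L k" for a
        using L(1)[of k] L(2)[of a k] by (subst int) (auto simp: z_def)
    qed (use L(1) that cont in \<open>auto intro!: continuous_intros\<close>)
    then show ?thesis using L(1)[of k] that by (simp add: int)
  qed
  have Cauchy_est: "norm (z j - z k) \<le> 1 / real (Suc j) + 1 / real (Suc k)" for j k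
  proof (rule field_le_epsilon)
    fix e :: real assume "e > 0"
    \<comment> \<open>long enough for the two leftover terms of \<open>key\<close> together to be \<open>e * T\<close>\<close>
    define T where "T = 2 * C * (L j + L k) / e"
    have "T > 0" using C(1) L(1) \<open>e > 0\<close> by (simp add: T_def add_pos_pos)
    have "norm (of_real T * (z j - z k))
        \<le> norm (integral {0..0 + T} g - of_real T * z k) + norm (integral {0..0 + T} g - of_real T * z j)"
      using dist_triangle3[of "of_real T * z j" "of_real T * z k" "integral {0..0 + T} g"]
      by (simp add: dist_norm algebra_simps)
    also have "\<dots> \<le> (T / real (Suc k) + 2 * C * L k) + (T / real (Suc j) + 2 * C * L j)"
      using \<open>T > 0\<close> by (intro add_mono key) auto
    also have "\<dots> = T * (1 / real (Suc j) + 1 / real (Suc k) + e)"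
      using \<open>e > 0\<close> by (simp add: T_def distrib_left)
    finally show "norm (z j - z k) \<le> 1 / real (Suc j) + 1 / real (Suc k) + e"
      using \<open>T > 0\<close> by (simp add: norm_mult)
  qed
  have "Cauchy z"
  proof (rule metric_CauchyI)
    fix e :: real assume "e > 0"
    then obtain n where n: "1 / real (Suc n) < e / 2"
      using nat_approx_posE[of "e / 2"] by auto
    have "1 / real (Suc j) < e / 2" if "j \<ge> n" for j
      using n that by (intro le_less_trans[OF _ n] divide_left_mono) auto
    then have "dist (z i) (z j) < e" if "i \<ge> n" "j \<ge> n" for i j
      using Cauchy_est[of i j] that by (smt (verit) dist_norm field_sum_of_halves)
    then show "\<exists>M. \<forall>m\<ge>M. \<forall>n\<ge>M. dist (z m) (z n) < e" by blast
  qed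
  then obtain m where m: "z \<longlonglongrightarrow> m" using Cauchy_convergent_iff convergentD by blast
  have mz: "norm (m - z k) \<le> 1 / real (Suc k)" for k
  proof (rule LIMSEQ_le)
    show "(\<lambda>j. norm (z j - z k)) \<longlonglongrightarrow> norm (m - z k)" by (intro tendsto_intros m)
    show "(\<lambda>j. 1 / real (Suc j) + 1 / real (Suc k)) \<longlonglongrightarrow> 1 / real (Suc k)"
      using tendsto_add[OF LIMSEQ_Suc[OF lim_1_over_n] tendsto_const, of "1 / real (Suc k)"] by simp
  qed (use Cauchy_est in auto)
  have "has_mean g m"
    unfolding has_mean_def
  proof (intro allI impI)
    fix e :: real assume "e > 0"
    then obtain k where k: "1 / real (Suc k) < e / 4" using nat_approx_posE[of "e / 4"] by auto
    show "\<exists>T\<^sub>0>0. \<forall>T\<ge>T\<^sub>0. \<forall>a. norm (integral {a..a + T} g - of_real T * m) \<le> e * T"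
    proof (intro exI[of _ "4 * C * L k / e"] conjI allI impI)
      show "0 < 4 * C * L k / e" using C L(1) \<open>e > 0\<close> by simp
      fix T a assume T: "T \<ge> 4 * C * L k / e"
      then have "T > 0" using \<open>0 < 4 * C * L k / e\<close> by linarith
      have "2 * C * L k \<le> T * (e / 2)" using T \<open>e > 0\<close> by (simp add: field_simps)
      moreover have "T * (1 / real (Suc k)) \<le> T * (e / 4)"
        using k \<open>T > 0\<close> by (intro mult_left_mono) auto
      moreover have "norm (of_real T * z k - of_real T * m) \<le> T * (1 / real (Suc k))"
        using mult_left_mono[OF mz[of k], of T] \<open>T > 0\<close> unfolding right_diff_distrib[symmetric] norm_mult
        by (simp add: norm_minus_commute del: of_nat_Suc)
      moreover have "norm (integral {a..a + T} g - of_real T * z k) \<le> T * (1 / real (Suc k)) + 2 * C * L k"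
        using key[of T a k] \<open>T > 0\<close> by simp
      moreover have "norm (integral {a..a + T} g - of_real T * m)
         \<le> norm (integral {a..a + T} g - of_real T * z k) + norm (of_real T * z k - of_real T * m)"
        using dist_triangle[of "integral {a..a + T} g" "of_real T * m" "of_real T * z k"]
        by (simp only: dist_norm)
      ultimately show "norm (integral {a..a + T} g - of_real T * m) \<le> e * T"
        by (simp only: mult.commute[of e])
    qed
  qed
  then show thesis by (rule that)
qed

lemma has_mean_symmetric:
  assumes "has_mean g m"
  shows "((\<lambda>T. integral {-T..T} g / of_real (2 * T)) \<longlongrightarrow> m) at_top"
proof (rule tendstoI)
  fix e :: real assume "e > 0"
  then obtain T0 where T0: "T0 > 0" "\<And>T a. T \<ge> T0 \<Longrightarrow> norm (integral {a..a + T} g - of_real T * m) \<le> e / 2 * T"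
    using assms unfolding has_mean_def by (metis half_gt_zero)
  have "dist (integral {-T..T} g / of_real (2 * T)) m < e" if "T \<ge> T0" for T
  proof -
    have "T > 0" using T0(1) that by linarith
    have "integral {-T..T} g / of_real (2 * T) - m
        = (integral {-T..-T + 2 * T} g - of_real (2 * T) * m) / of_real (2 * T)"
      using \<open>T > 0\<close> by (simp add: field_simps)
    also have "norm \<dots> \<le> (e / 2 * (2 * T)) / (2 * T)"
      unfolding norm_divide using \<open>T > 0\<close> \<open>e > 0\<close> that T0(1) T0(2)[of "2 * T" "-T"]
      by (intro frac_le) auto
    also have "\<dots> < e" using \<open>T > 0\<close> \<open>e > 0\<close> by simp
    finally show ?thesis by (simp add: dist_norm)
  qed
  then show "\<forall>\<^sub>F T in at_top. dist (integral {-T..T} g / of_real (2 * T)) m < e"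
    unfolding eventually_at_top_linorder by blast
qed

lemma has_mean_diff:
  assumes "has_mean f m" "has_mean g n" "continuous_on UNIV f" "continuous_on UNIV g"
  shows "has_mean (\<lambda>t. f t - g t) (m - n)"
  unfolding has_mean_def
proof (intro allI impI)
  fix e :: real assume "e > 0"
  obtain S where S: "S > 0" "\<And>T a. T \<ge> S \<Longrightarrow> norm (integral {a..a + T} f - of_real T * m) \<le> e / 2 * T"
    using assms(1) \<open>e > 0\<close> unfolding has_mean_def by (metis half_gt_zero)
  obtain R where R: "R > 0" "\<And>T a. T \<ge> R \<Longrightarrow> norm (integral {a..a + T} g - of_real T * n) \<le> e / 2 * T"
    using assms(2) \<open>e > 0\<close> unfolding has_mean_def by (metis half_gt_zero)
  show "\<exists>T\<^sub>0>0. \<forall>T\<ge>T\<^sub>0. \<forall>a. norm (integral {a..a + T} (\<lambda>t. f t - g t) - of_real T * (m - n)) \<le> e * T"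
  proof (intro exI[of _ "max S R"] conjI allI impI)
    fix T a assume T: "T \<ge> max S R"
    have "integral {a..a + T} (\<lambda>t. f t - g t) - of_real T * (m - n)
        = (integral {a..a + T} f - of_real T * m) - (integral {a..a + T} g - of_real T * n)"
      using Henstock_Kurzweil_Integration.integral_diff[OF window_integrable[OF assms(3)] window_integrable[OF assms(4)]]
      by (simp add: algebra_simps)
    also have "norm \<dots> \<le> e / 2 * T + e / 2 * T"
      using T by (intro order_trans[OF norm_triangle_ineq4] add_mono S R) auto
    finally show "norm (integral {a..a + T} (\<lambda>t. f t - g t) - of_real T * (m - n)) \<le> e * T"
      by (simp add: mult.commute)
  qed (use S in auto)
qed

lemma has_mean_cmult:
  assumes "has_mean g m" shows "has_mean (\<lambda>t. c * g t) (c * m)"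
proof (cases "c = 0")
  case True
  then show ?thesis by (auto simp: has_mean_def intro!: exI[of _ "1::real"])
next
  case False
  show ?thesis
    unfolding has_mean_def
  proof (intro allI impI)
    fix e :: real assume "e > 0"
    then have "e / norm c > 0" using False by simp
    then obtain S where S: "S > 0" "\<And>T a. T \<ge> S \<Longrightarrow> norm (integral {a..a + T} g - of_real T * m) \<le> e / norm c * T"
      using assms unfolding has_mean_def by blast
    have "norm (integral {a..a + T} (\<lambda>t. c * g t) - of_real T * (c * m)) \<le> e * T" if "T \<ge> S" for T a
    proof -
      have "integral {a..a + T} (\<lambda>t. c * g t) - of_real T * (c * m)
          = c * (integral {a..a + T} g - of_real T * m)"
        by (simp add: algebra_simps)
      also have "norm \<dots> \<le> norm c * (e / norm c * T)"
        unfolding norm_mult using S(2)[OF that] by (intro mult_left_mono) auto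
      finally show ?thesis using False by simp
    qed
    then show "\<exists>T\<^sub>0>0. \<forall>T\<ge>T\<^sub>0. \<forall>a. norm (integral {a..a + T} (\<lambda>t. c * g t) - of_real T * (c * m)) \<le> e * T"
      using S(1) by blast
  qed
qed

lemma has_mean_translate:
  assumes "has_mean g m" "continuous_on UNIV g" shows "has_mean (\<lambda>t. g (t + c)) m"
proof -
  have "integral {a..a + T} (\<lambda>t. g (t + c)) = integral {a + c..(a + c) + T} g" for a T
    by (simp add: window_shift[OF assms(2)] add.assoc add.commute[of T])
  then show ?thesis using assms(1) unfolding has_mean_def by metis
qed

lemma has_mean_zero: "has_mean (\<lambda>t. 0) 0"
  by (auto simp: has_mean_def intro!: exI[of _ "1::real"])

lemma has_mean_sum:
  assumes "\<And>i. i \<in> I \<Longrightarrow> has_mean (f i) (m i)" "\<And>i. i \<in> I \<Longrightarrow> continuous_on UNIV (f i)"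
  shows "has_mean (\<lambda>t. \<Sum>i\<in>I. f i t) (\<Sum>i\<in>I. m i)"
  using assms
proof (induction I rule: infinite_finite_induct)
  case (insert i I)
  have "has_mean (\<lambda>t. f i t - (-1) * (\<Sum>i\<in>I. f i t)) (m i - (-1) * (\<Sum>i\<in>I. m i))"
    using insert by (intro has_mean_diff has_mean_cmult continuous_intros) auto
  then show ?case using insert.hyps by simp
qed (simp_all add: has_mean_zero)

lemma has_mean_close:
  assumes "has_mean f m" "has_mean g n" "continuous_on UNIV f" "continuous_on UNIV g"
    and "\<And>t. norm (f t - g t) \<le> \<delta>"
  shows "norm (m - n) \<le> \<delta>"
proof (rule tendsto_upperbound)
  show "((\<lambda>T. norm (integral {-T..T} (\<lambda>t. f t - g t) / of_real (2 * T))) \<longlongrightarrow> norm (m - n)) at_top"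
    using assms by (intro tendsto_norm has_mean_symmetric has_mean_diff)
  show "\<forall>\<^sub>F T in at_top. norm (integral {-T..T} (\<lambda>t. f t - g t) / of_real (2 * T)) \<le> \<delta>"
    using eventually_gt_at_top[of 0]
  proof eventually_elim
    case (elim T)
    have "norm (integral {-T..T} (\<lambda>t. f t - g t)) \<le> \<delta> * (T - - T)"
      using assms elim by (intro window_bound) (auto intro!: continuous_intros)
    then show ?case using elim by (simp add: norm_divide field_simps)
  qed
qed simp

lemma has_mean_cis: "has_mean (\<lambda>t. cis (x * t)) (if x = 0 then 1 else 0)"
proof (cases "x = 0")
  case True
  have "norm (integral {a..a + T} (\<lambda>t. cis (x * t)) - of_real T * 1) = 0" if "T \<ge> 1" for T a
    using True that by (simp add: scaleR_conv_of_real)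
  then show ?thesis
    unfolding has_mean_def using True by (auto intro!: exI[of _ "1::real"])
next
  case False
  have bound: "norm (integral {a..a + T} (\<lambda>t. cis (x * t))) \<le> 2 / \<bar>x\<bar>" if "T \<ge> 0" for T a
  proof -
    have "((\<lambda>t. cis (x * t)) has_integral (cis (x * (a + T)) / (\<i> * of_real x) - cis (x * a) / (\<i> * of_real x))) {a..a + T}"
    proof (intro fundamental_theorem_of_calculus)
      fix t
      have "((\<lambda>z. exp (\<i> * of_real x * z) / (\<i> * of_real x)) has_field_derivative
          exp (\<i> * of_real x * of_real t)) (at (of_real t))"
        using False by (auto intro!: derivative_eq_intros)
      from has_vector_derivative_real_field[OF this]
      show "((\<lambda>t. cis (x * t) / (\<i> * of_real x)) has_vector_derivative cis (x * t)) (at t within {a..a + T})"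
        by (simp add: cis_conv_exp mult.assoc)
    qed (use that in auto)
    then have "norm (integral {a..a + T} (\<lambda>t. cis (x * t)))
        = norm (cis (x * (a + T)) / (\<i> * of_real x) - cis (x * a) / (\<i> * of_real x))"
      by (simp add: integral_unique)
    also have "\<dots> \<le> 1 / \<bar>x\<bar> + 1 / \<bar>x\<bar>"
      by (intro order_trans[OF norm_triangle_ineq4]) (simp add: norm_divide norm_mult)
    finally show ?thesis by simp
  qed
  show ?thesis
    unfolding has_mean_def
  proof (intro allI impI)
    fix e :: real assume "e > 0"
    show "\<exists>T\<^sub>0>0. \<forall>T\<ge>T\<^sub>0. \<forall>a. norm (integral {a..a + T} (\<lambda>t. cis (x * t)) - of_real T * (if x = 0 then 1 else 0)) \<le> e * T"
    proof (intro exI[of _ "2 / (\<bar>x\<bar> * e)"] conjI allI impI)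
      show "2 / (\<bar>x\<bar> * e) > 0" using \<open>e > 0\<close> False by simp
      fix T a assume T: "T \<ge> 2 / (\<bar>x\<bar> * e)"
      then have "T \<ge> 0" using \<open>2 / (\<bar>x\<bar> * e) > 0\<close> by linarith
      have "2 / \<bar>x\<bar> \<le> e * T" using T \<open>e > 0\<close> False by (simp add: field_simps)
      then show "norm (integral {a..a + T} (\<lambda>t. cis (x * t)) - of_real T * (if x = 0 then 1 else 0)) \<le> e * T"
        using bound[OF \<open>T \<ge> 0\<close>, of a] False by simp
    qed
  qed
qed

section \<open>The uniqueness theorem for almost periodic functions\<close>

lemma almost_periodic_translate:
  assumes "almost_periodic g" shows "almost_periodic (\<lambda>t. g (t + c))"
  unfolding almost_periodic_def
proof (intro conjI allI impI)
  show "continuous_on UNIV (\<lambda>t. g (t + c))"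
    by (intro continuous_on_compose2[OF almost_periodic_continuous[OF assms, of UNIV]] continuous_intros) auto
  fix e :: real assume "e > 0"
  then obtain A where A: "finite A" "\<And>a. \<exists>b\<in>A. \<forall>x. norm (g (x + a) - g (x + b)) \<le> e"
    using almost_periodic_net[OF assms] by blast
  have "\<exists>b\<in>A. \<forall>x. norm (g (x + a + c) - g (x + b + c)) \<le> e" for a
    using A(2)[of a] by (metis add.commute add.left_commute)
  then show "\<exists>A. finite A \<and> (\<forall>a. \<exists>b\<in>A. \<forall>x. norm (g (x + a + c) - g (x + b + c)) \<le> e)"
    using A(1) by blast
qed

lemma norm_cis_minus_1_le: "norm (cis y - 1) \<le> \<bar>y\<bar>"
  using dist_exp_i_1[of y] abs_sin_x_le_abs_x[of "y / 2"] by (simp add: cis_conv_exp)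

text \<open>Vanishing of the mean at each single frequency becomes uniform over a compact range of
  frequencies: a window length that works at \<open>x\<close> works, with a slightly larger constant, near \<open>x\<close>,
  finitely many neighbourhoods cover the range, and \<open>window_split\<close> passes to a common length.\<close>

lemma zero_means_uniform:
  assumes v: "almost_periodic v" and mean: "\<And>x. has_mean (\<lambda>t. v t * cis (x * t)) 0" and \<eta>: "\<eta> > 0"
  obtains T\<^sub>0 where "T\<^sub>0 > 0"
    "\<And>T x a. T \<ge> T\<^sub>0 \<Longrightarrow> \<bar>x\<bar> \<le> R \<Longrightarrow> norm (integral {a..a + T} (\<lambda>t. v t * cis (x * t))) \<le> \<eta> * T"
proof -
  note cont = almost_periodic_continuous[OF v]
  obtain C where C: "C > 0" "\<And>x. norm (v x) \<le> C" using almost_periodic_bounded[OF v] by blast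
  have "\<exists>S>0. \<forall>a. norm (integral {a..a + S} (\<lambda>t. v t * cis (x * t))) \<le> \<eta> / 2 * S" for x
  proof -
    have "\<exists>T\<^sub>0>0. \<forall>T\<ge>T\<^sub>0. \<forall>a. norm (integral {a..a + T} (\<lambda>t. v t * cis (x * t)) - of_real T * 0) \<le> \<eta> / 2 * T"
      using mean[of x] half_gt_zero[OF \<eta>] unfolding has_mean_def by blast
    then show ?thesis by auto
  qed
  then obtain S where S: "\<And>x. S x > 0"
    "\<And>x a. norm (integral {a..a + S x} (\<lambda>t. v t * cis (x * t))) \<le> \<eta> / 2 * S x" by metis
  define d where "d = (\<lambda>x. \<eta> / (4 * C * S x))"
  have d: "d x > 0" for x using \<eta> C S by (simp add: d_def)
  \<comment> \<open>a window of length S x that works for the frequency x works for all nearby frequencies\<close>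
  have near: "norm (integral {a..a + S x} (\<lambda>t. v t * cis (y * t))) \<le> (3 / 4 * \<eta>) * S x"
    if "\<bar>y - x\<bar> < d x" for x y a
  proof -
    let ?k = "cis ((y - x) * a)"
    have "v t * cis (y * t) = ?k * (v t * cis (x * t)) + v t * cis (x * t) * ?k * (cis ((y - x) * (t - a)) - 1)" for t
      by (simp add: algebra_simps flip: cis_mult cis_divide)
    then have "integral {a..a + S x} (\<lambda>t. v t * cis (y * t))
        = integral {a..a + S x} (\<lambda>t. ?k * (v t * cis (x * t)) + v t * cis (x * t) * ?k * (cis ((y - x) * (t - a)) - 1))"
      by presburger
    also have "\<dots> = integral {a..a + S x} (\<lambda>t. ?k * (v t * cis (x * t)))
        + integral {a..a + S x} (\<lambda>t. v t * cis (x * t) * ?k * (cis ((y - x) * (t - a)) - 1))"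
      by (intro Henstock_Kurzweil_Integration.integral_add window_integrable continuous_intros cont)
    also have "norm \<dots> \<le> \<eta> / 2 * S x + C * (d x * S x) * (a + S x - a)"
    proof (intro norm_triangle_mono)
      show "norm (integral {a..a + S x} (\<lambda>t. ?k * (v t * cis (x * t)))) \<le> \<eta> / 2 * S x"
        using S(2)[of a x] by (simp add: norm_mult)
      show "norm (integral {a..a + S x} (\<lambda>t. v t * cis (x * t) * ?k * (cis ((y - x) * (t - a)) - 1)))
          \<le> C * (d x * S x) * (a + S x - a)"
      proof (intro integral_bound)
        fix t assume t: "t \<in> {a..a + S x}"
        have "norm (cis ((y - x) * (t - a)) - 1) \<le> \<bar>(y - x) * (t - a)\<bar>" by (rule norm_cis_minus_1_le)
        also have "\<dots> \<le> d x * S x"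
          unfolding abs_mult using t that d[of x] by (intro mult_mono) auto
        finally show "norm (v t * cis (x * t) * ?k * (cis ((y - x) * (t - a)) - 1)) \<le> C * (d x * S x)"
          unfolding norm_mult norm_cis mult_1_right using C by (intro mult_mono) auto
      qed (use S(1)[of x] in \<open>auto intro!: continuous_intros cont\<close>)
    qed
    also have "\<dots> = (3 / 4 * \<eta>) * S x"
      using S(1)[of x] C(1) by (simp add: d_def field_simps)
    finally show ?thesis .
  qed
  obtain D where D: "finite D" "{-R..R} \<subseteq> (\<Union>x\<in>D. ball x (d x))"
  proof (rule compactE_image[of "{-R..R}" "{-R..R}" "\<lambda>x. ball x (d x)"])
    show "{-R..R} \<subseteq> (\<Union>x\<in>{-R..R}. ball x (d x))" using d by force
  qed auto
  define T0 where "T0 = Max (insert 1 ((\<lambda>x. 4 * C * S x / \<eta>) ` D))"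
  show thesis
  proof (rule that[of T0])
    show "T0 > 0" unfolding T0_def using D(1) by (subst Max_gr_iff) auto
    fix T x a assume T: "T \<ge> T0" and x: "\<bar>x\<bar> \<le> R"
    have "x \<in> {-R..R}" using x by auto
    then obtain y where "y \<in> D" "x \<in> ball y (d y)" using D(2) by blast
    then have y: "y \<in> D" "\<bar>x - y\<bar> < d y" by (auto simp: dist_real_def abs_minus_commute)
    have "4 * C * S y / \<eta> \<le> T0" unfolding T0_def using D(1) y(1) by (intro Max_ge) auto
    then have "4 * C * S y / \<eta> \<le> T" using T by linarith
    then have "C * S y \<le> \<eta> / 4 * T" using \<eta> by (simp add: field_simps)
    have "T \<ge> 0" using T \<open>T0 > 0\<close> by linarith
    have "norm (integral {a..a + T} (\<lambda>t. v t * cis (x * t))) \<le> T / S y * ((3 / 4 * \<eta>) * S y) + C * S y"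
      using near[OF y(2)] C S(1)[of y] \<open>T \<ge> 0\<close>
      by (intro window_split continuous_intros cont) (auto simp: norm_mult)
    also have "\<dots> \<le> (3 / 4 * \<eta>) * T + \<eta> / 4 * T"
      using S(1)[of y] \<open>C * S y \<le> \<eta> / 4 * T\<close> by (simp add: mult.commute)
    also have "\<dots> = \<eta> * T" by simp
    finally show "norm (integral {a..a + T} (\<lambda>t. v t * cis (x * t))) \<le> \<eta> * T" .
  qed
qed

text \<open>For \<open>x \<noteq> 0\<close> the integral is \<open>2 sin (x h / 2) / x\<close>. The quadratic lower bound for the cosine is enough up to
  \<open>\<bar>x\<bar> h = pi\<close>, because \<open>pi\<^sup>2 \<le> 12\<close>.\<close>

lemma norm_integral_cis_ge:
  assumes "\<bar>x\<bar> * h \<le> pi" "h > 0"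
  shows "h / 2 \<le> norm (integral {-h/2..h/2} (\<lambda>s. cis (x * s)))"
proof -
  have int: "((\<lambda>s. 1 - x\<^sup>2 * s\<^sup>2 / 2) has_integral
      ((h/2) - x\<^sup>2 * (h/2)^3 / 6) - ((-h/2) - x\<^sup>2 * (-h/2)^3 / 6)) {-h/2..h/2}"
    using assms(2) by (intro fundamental_theorem_of_calculus)
      (auto intro!: derivative_eq_intros simp flip: has_real_derivative_iff_has_vector_derivative simp: power2_eq_square)
  have "h / 2 \<le> ((h/2) - x\<^sup>2 * (h/2)^3 / 6) - ((-h/2) - x\<^sup>2 * (-h/2)^3 / 6)"
  proof -
    have "(\<bar>x\<bar> * h)\<^sup>2 \<le> pi\<^sup>2" using assms by (intro power_mono) auto
    also have "\<dots> \<le> 3.2\<^sup>2" using pi_approx by (intro power_mono) auto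
    also have "(3.2::real)\<^sup>2 \<le> 12" by (simp add: power2_eq_square)
    finally have "h * (x * h)\<^sup>2 \<le> h * 12"
      using assms(2) by (intro mult_left_mono) (auto simp: power_mult_distrib)
    then show ?thesis by (simp add: power2_eq_square power3_eq_cube field_simps)
  qed
  also have "\<dots> = integral {-h/2..h/2} (\<lambda>s. 1 - x\<^sup>2 * s\<^sup>2 / 2)"
    using int by (simp add: integral_unique)
  also have "\<dots> \<le> integral {-h/2..h/2} (\<lambda>s. Re (cis (x * s)))"
  proof (rule integral_le)
    show "(\<lambda>s. 1 - x\<^sup>2 * s\<^sup>2 / 2) integrable_on {-h/2..h/2}" using int by blast
    show "(\<lambda>s. Re (cis (x * s))) integrable_on {-h/2..h/2}"
      by (intro integrable_continuous_real continuous_intros)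
    show "1 - x\<^sup>2 * s\<^sup>2 / 2 \<le> Re (cis (x * s))" for s
    proof -
      have "(sin (x * s / 2))\<^sup>2 \<le> (x * s / 2)\<^sup>2"
        using abs_sin_x_le_abs_x[of "x * s / 2"] by (simp only: abs_le_square_iff)
      moreover have "cos (x * s) = 1 - 2 * (sin (x * s / 2))\<^sup>2"
        using cos_double_sin[of "x * s / 2"] by simp
      ultimately show ?thesis by (simp add: power_mult_distrib power_divide)
    qed
  qed
  also have "\<dots> = Re (integral {-h/2..h/2} (\<lambda>s. cis (x * s)))"
    by (intro integral_unique has_integral_Re integrable_integral integrable_continuous_real continuous_intros)
  also have "\<dots> \<le> norm (integral {-h/2..h/2} (\<lambda>s. cis (x * s)))"
    by (rule complex_Re_le_cmod)
  finally show ?thesis .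
qed

lemma sum_of_cells:
  fixes g :: "real \<Rightarrow> complex"
  assumes "continuous_on UNIV g" "h > 0"
  shows "(\<Sum>n\<in>{m..<m + int k}. integral {h * of_int n - h/2..h * of_int n + h/2} g)
       = integral {h * of_int m - h/2..h * of_int m - h/2 + real k * h} g"
proof (induction k)
  case (Suc k)
  have "{m..<m + int (Suc k)} = insert (m + int k) {m..<m + int k}" by auto
  moreover have "integral {h * of_int m - h/2..h * of_int m - h/2 + real (Suc k) * h} g
      = integral {h * of_int m - h/2..h * of_int m - h/2 + real k * h} g
      + integral {h * of_int m - h/2 + real k * h..h * of_int m - h/2 + real (Suc k) * h} g"
    using assms(2) by (intro window_combine assms) (auto simp: algebra_simps)
  ultimately show ?case using Suc by (simp add: algebra_simps)
qed simp

text \<open>Sampling an almost periodic function on a fine grid keeps its exponential sums small for every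
  frequency that the grid can resolve. If \<open>v\<close> hardly varies over a cell of length \<open>h\<close>, then the sum
  times the integral of the exponential over one cell is close to the integral of \<open>v\<close> against that
  exponential over all cells. That integral is small uniformly in the frequency by
  \<open>zero_means_uniform\<close>, and the factor for one cell is at least \<open>h / 2\<close>. Only the compact range
  \<open>\<bar>x\<bar> \<le> pi / h\<close> of frequencies enters, since \<open>h\<close> is fixed before the number of samples.\<close>

lemma sample_sums_small:
  assumes v: "almost_periodic v" and mean: "\<And>x. has_mean (\<lambda>t. v t * cis (x * t)) 0" and \<epsilon>: "\<epsilon> > 0"
  obtains h N where "h > 0" "N \<ge> (1::nat)"
    "\<And>\<xi>. \<bar>\<xi>\<bar> \<le> pi \<Longrightarrow>
       norm (\<Sum>n\<in>{-int N..<int N}. v (h * of_int n) * cis (- \<xi> * of_int n)) \<le> \<epsilon> * real N"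
proof -
  note cont = almost_periodic_continuous[OF v]
  obtain h where "h > 0" and h: "\<And>x y. dist y x < h \<Longrightarrow> dist (v y) (v x) < \<epsilon> / 8"
    using almost_periodic_uniformly_continuous[OF v] \<epsilon> unfolding uniformly_continuous_on_def
    by (metis UNIV_I zero_less_divide_iff zero_less_numeral)
  obtain T0 where "T0 > 0" and T0: "\<And>T x a. T \<ge> T0 \<Longrightarrow> \<bar>x\<bar> \<le> pi / h \<Longrightarrow>
      norm (integral {a..a + T} (\<lambda>t. v t * cis (x * t))) \<le> \<epsilon> / 8 * T"
    using zero_means_uniform[OF v mean, of "\<epsilon> / 8" "pi / h"] \<epsilon> by auto
  define N where "N = nat \<lceil>T0 / h\<rceil>"
  have "T0 / h > 0" using \<open>h > 0\<close> \<open>T0 > 0\<close> by simp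
  then have "real N \<ge> T0 / h" "N \<ge> 1" unfolding N_def by linarith+
  then have N: "T0 \<le> real N * h" "N \<ge> 1" using \<open>h > 0\<close> by (auto simp: field_simps)
  show thesis
  proof (rule that[OF \<open>h > 0\<close> N(2)])
    fix \<xi> :: real assume \<xi>: "\<bar>\<xi>\<bar> \<le> pi"
    \<comment> \<open>the frequency on the line whose samples on the grid have phase \<open>- \<xi> * n\<close>\<close>
    define x where "x = - \<xi> / h"
    have xh: "x * h = - \<xi>" using \<open>h > 0\<close> by (simp add: x_def)
    define g where "g = (\<lambda>t. v t * cis (x * t))"
    have g: "continuous_on UNIV g" unfolding g_def by (intro continuous_intros cont)
    define \<kappa> where "\<kappa> = integral {-h/2..h/2} (\<lambda>s. cis (x * s))"
    let ?D = "{-int N..<int N}"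
    have \<kappa>: "h / 2 \<le> norm \<kappa>"
      unfolding \<kappa>_def using \<xi> \<open>h > 0\<close> by (intro norm_integral_cis_ge) (auto simp: x_def)
    have cell: "norm (\<kappa> * (v (h * of_int n) * cis (- \<xi> * of_int n))
        - integral {h * of_int n - h/2..h * of_int n + h/2} g) \<le> \<epsilon> / 8 * h" for n
    proof -
      let ?c = "h * of_int n"
      have phase: "cis (x * (s + ?c)) = cis (x * s) * cis (- \<xi> * of_int n)" for s
        unfolding cis_mult xh[symmetric] by (simp add: algebra_simps)
      have "integral {?c - h/2..?c + h/2} g = integral {-h/2..h/2} (\<lambda>s. g (s + ?c))"
        by (simp add: window_shift[OF g] add.commute)
      moreover have "\<kappa> * (v ?c * cis (- \<xi> * of_int n))
          = integral {-h/2..h/2} (\<lambda>s. v ?c * cis (x * (s + ?c)))"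
        unfolding phase \<kappa>_def by (simp add: mult_ac)
      ultimately have "\<kappa> * (v ?c * cis (- \<xi> * of_int n)) - integral {?c - h/2..?c + h/2} g
          = integral {-h/2..h/2} (\<lambda>s. v ?c * cis (x * (s + ?c)) - g (s + ?c))"
        by (simp only:) (intro Henstock_Kurzweil_Integration.integral_diff[symmetric] window_integrable
          continuous_intros continuous_on_compose2[OF g], auto)
      also have "norm \<dots> \<le> \<epsilon> / 8 * (h/2 - (-h/2))"
      proof (intro integral_bound)
        fix s assume s: "s \<in> {-h/2..h/2}"
        have "norm (v ?c * cis (x * (s + ?c)) - g (s + ?c)) = dist (v ?c) (v (s + ?c))"
          by (simp add: g_def dist_norm norm_mult flip: left_diff_distrib)
        also have "\<dots> < \<epsilon> / 8" using s \<open>h > 0\<close> by (intro h) (auto simp: dist_real_def)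
        finally show "norm (v ?c * cis (x * (s + ?c)) - g (s + ?c)) \<le> \<epsilon> / 8" by simp
      qed (use \<open>h > 0\<close> in \<open>auto intro!: continuous_intros continuous_on_compose2[OF g]\<close>)
      finally show ?thesis by simp
    qed
    let ?U = "\<Sum>n\<in>?D. v (h * of_int n) * cis (- \<xi> * of_int n)"
    have "\<kappa> * ?U = (\<Sum>n\<in>?D. \<kappa> * (v (h * of_int n) * cis (- \<xi> * of_int n))
        - integral {h * of_int n - h/2..h * of_int n + h/2} g)
        + integral {h * of_int (-int N) - h/2..h * of_int (-int N) - h/2 + real (2 * N) * h} g"
      using sum_of_cells[OF g \<open>h > 0\<close>, of "-int N" "2 * N"]
      by (simp add: sum_subtractf sum_distrib_left)
    also have "norm \<dots> \<le> real (2 * N) * (\<epsilon> / 8 * h) + \<epsilon> / 8 * (real (2 * N) * h)"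
    proof (intro norm_triangle_mono)
      show "norm (\<Sum>n\<in>?D. \<kappa> * (v (h * of_int n) * cis (- \<xi> * of_int n))
        - integral {h * of_int n - h/2..h * of_int n + h/2} g) \<le> real (2 * N) * (\<epsilon> / 8 * h)"
        using sum_norm_le[of ?D _ "\<lambda>_. \<epsilon> / 8 * h", OF cell] by simp
      show "norm (integral {h * of_int (-int N) - h/2..h * of_int (-int N) - h/2 + real (2 * N) * h} g)
          \<le> \<epsilon> / 8 * (real (2 * N) * h)"
        unfolding g_def using N \<open>h > 0\<close> \<xi> \<open>T0 > 0\<close> by (intro T0) (auto simp: x_def divide_right_mono)
    qed
    also have "\<dots> = h / 2 * (\<epsilon> * real N)" by (simp add: field_simps)
    finally have "norm \<kappa> * norm ?U \<le> h / 2 * (\<epsilon> * real N)" by (simp add: norm_mult)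
    moreover have "h / 2 * norm ?U \<le> norm \<kappa> * norm ?U" using \<kappa> by (intro mult_right_mono) auto
    ultimately have "h / 2 * norm ?U \<le> h / 2 * (\<epsilon> * real N)" by linarith
    then show "norm ?U \<le> \<epsilon> * real N" using \<open>h > 0\<close> by simp
  qed
qed

lemma has_integral_cis_period:
  "((\<lambda>\<xi>. cis (\<xi> * of_int d)) has_integral (if d = 0 then of_real (2 * pi) else 0)) {-pi..pi}"
proof (cases "d = 0")
  case True
  then show ?thesis using has_integral_const_real[of "1::complex" "-pi" pi] by (simp add: scaleR_conv_of_real)
next
  case False
  have "((\<lambda>\<xi>. cis (\<xi> * of_int d)) has_integral
      (cis (pi * of_int d) / (\<i> * of_int d) - cis (-pi * of_int d) / (\<i> * of_int d))) {-pi..pi}"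
  proof (intro fundamental_theorem_of_calculus)
    fix t
    have "((\<lambda>z. exp (\<i> * of_int d * z) / (\<i> * of_int d)) has_field_derivative
        exp (\<i> * of_int d * of_real t)) (at (of_real t))"
      using False by (auto intro!: derivative_eq_intros)
    from has_vector_derivative_real_field[OF this]
    show "((\<lambda>t. cis (t * of_int d) / (\<i> * of_int d)) has_vector_derivative cis (t * of_int d)) (at t within {-pi..pi})"
      by (simp add: cis_conv_exp mult_ac)
  qed simp
  moreover have "cis (pi * of_int d) = cis (-pi * of_int d)"
    by (rule complex_eqI) (auto simp: sin_times_pi_eq_0 mult.commute[of pi])
  ultimately show ?thesis using False by simp
qed

text \<open>A Toeplitz form is dominated by the supremum of its symbol: on the circle the form at the
  indicator of \<open>I\<close> is the integral of the symbol against \<open>\<bar>E\<bar>\<^sup>2\<close>, where \<open>E\<close> is the exponential sum over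
  \<open>I\<close>, and the integral of \<open>\<bar>E\<bar>\<^sup>2\<close> counts \<open>I\<close> by orthogonality.\<close>

lemma toeplitz_form_bound:
  fixes v :: "int \<Rightarrow> complex"
  assumes I: "I \<subseteq> {0..<int N}"
    and S: "\<And>\<xi>. \<bar>\<xi>\<bar> \<le> pi \<Longrightarrow> norm (\<Sum>n\<in>{-int N..<int N}. v n * cis (- \<xi> * of_int n)) \<le> S"
  shows "norm (\<Sum>j\<in>I. \<Sum>i\<in>I. v (j - i)) \<le> S * real (card I)"
proof -
  have fin: "finite I" using I finite_subset by blast
  let ?D = "{-int N..<int N}"
  define U where "U = (\<lambda>\<xi>. \<Sum>n\<in>?D. v n * cis (- \<xi> * of_int n))"
  define E where "E = (\<lambda>\<xi>. \<Sum>j\<in>I. cis (\<xi> * of_int j))"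
  have EE: "E \<xi> * cnj (E \<xi>) = (\<Sum>j\<in>I. \<Sum>i\<in>I. cis (\<xi> * of_int (j - i)))" for \<xi>
    by (simp add: E_def sum_product cis_mult cis_cnj algebra_simps)
  have UEE: "U \<xi> * (E \<xi> * cnj (E \<xi>)) = (\<Sum>n\<in>?D. \<Sum>j\<in>I. \<Sum>i\<in>I. v n * cis (\<xi> * of_int (j - i - n)))" for \<xi>
    unfolding EE U_def sum_distrib_right
    by (intro sum.cong refl) (simp add: sum_distrib_left mult.assoc cis_mult algebra_simps)
  have 1: "((\<lambda>\<xi>. U \<xi> * (E \<xi> * cnj (E \<xi>))) has_integral
      (\<Sum>n\<in>?D. \<Sum>j\<in>I. \<Sum>i\<in>I. v n * (if j - i - n = 0 then of_real (2 * pi) else 0))) {-pi..pi}"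
    unfolding UEE by (intro has_integral_sum finite_atLeastLessThan_int fin has_integral_mult_right has_integral_cis_period)
  have "(\<Sum>n\<in>?D. \<Sum>j\<in>I. \<Sum>i\<in>I. v n * (if j - i - n = 0 then of_real (2 * pi) else 0))
      = (\<Sum>j\<in>I. \<Sum>i\<in>I. \<Sum>n\<in>?D. v n * (if j - i - n = 0 then of_real (2 * pi) else 0))"
    by (subst sum.swap) (intro sum.cong refl sum.swap)
  also have "\<dots> = (\<Sum>j\<in>I. \<Sum>i\<in>I. v (j - i) * of_real (2 * pi))"
  proof (intro sum.cong refl)
    fix j i assume "j \<in> I" "i \<in> I"
    then have "0 \<le> i" "i < int N" "0 \<le> j" "j < int N" using I by auto
    then have ij: "j - i \<in> ?D" by auto
    have "(\<Sum>n\<in>?D. v n * (if j - i - n = 0 then of_real (2 * pi) else 0))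
        = (\<Sum>n\<in>?D. if n = j - i then v n * of_real (2 * pi) else 0)"
      by (intro sum.cong) auto
    then show "(\<Sum>n\<in>?D. v n * (if j - i - n = 0 then of_real (2 * pi) else 0)) = v (j - i) * of_real (2 * pi)"
      using ij by simp
  qed
  finally have int1: "integral {-pi..pi} (\<lambda>\<xi>. U \<xi> * (E \<xi> * cnj (E \<xi>)))
      = (\<Sum>j\<in>I. \<Sum>i\<in>I. v (j - i)) * of_real (2 * pi)"
    using integral_unique[OF 1] by (simp add: sum_distrib_right)
  have "((\<lambda>\<xi>. E \<xi> * cnj (E \<xi>)) has_integral
      (\<Sum>j\<in>I. \<Sum>i\<in>I. if j - i = 0 then of_real (2 * pi) else 0)) {-pi..pi}"
    unfolding EE by (intro has_integral_sum fin has_integral_cis_period)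
  moreover have "(\<Sum>j\<in>I. \<Sum>i\<in>I. if j - i = 0 then of_real (2 * pi) else 0) = (of_real (real (card I) * (2 * pi)) :: complex)"
    using fin by simp
  ultimately have "((\<lambda>\<xi>. of_real S * (E \<xi> * cnj (E \<xi>))) has_integral of_real S * of_real (real (card I) * (2 * pi))) {-pi..pi}"
    by (intro has_integral_mult_right) simp
  then have 2: "((\<lambda>\<xi>. Re (of_real S * (E \<xi> * cnj (E \<xi>)))) has_integral Re (of_real S * of_real (real (card I) * (2 * pi)))) {-pi..pi}"
    by (rule has_integral_Re)
  have "norm (integral {-pi..pi} (\<lambda>\<xi>. U \<xi> * (E \<xi> * cnj (E \<xi>))))
      \<le> integral {-pi..pi} (\<lambda>\<xi>. Re (of_real S * (E \<xi> * cnj (E \<xi>))))"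
  proof (rule integral_norm_bound_integral)
    show "norm (U \<xi> * (E \<xi> * cnj (E \<xi>))) \<le> Re (of_real S * (E \<xi> * cnj (E \<xi>)))" if "\<xi> \<in> {-pi..pi}" for \<xi>
    proof -
      have "norm (U \<xi>) \<le> S" unfolding U_def using that by (intro S) auto
      then have "norm (U \<xi>) * (norm (E \<xi>))\<^sup>2 \<le> S * (norm (E \<xi>))\<^sup>2" by (rule mult_right_mono) simp
      then show ?thesis
        by (simp add: norm_mult power2_eq_square flip: complex_norm_square) 
    qed
  qed (use 1 2 in blast)+
  then have "norm (\<Sum>j\<in>I. \<Sum>i\<in>I. v (j - i)) * (2 * pi) \<le> (S * real (card I)) * (2 * pi)"
    unfolding int1 integral_unique[OF 2] by (simp add: norm_mult mult_ac)
  then show ?thesis by simp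
qed

text \<open>The uniqueness theorem. Translate so that the point is the origin. A net of \<open>m\<close> translates
  splits the first \<open>N\<close> grid points into \<open>m\<close> classes, one of which, \<open>I\<close>, has at least \<open>N / m\<close> elements.
  For \<open>i\<close> and \<open>j\<close> in \<open>I\<close> the translates by \<open>h i\<close> and \<open>h j\<close> nearly coincide, so \<open>w (h (j - i))\<close> is close
  to \<open>w 0\<close>, and the Toeplitz form of the samples at the indicator of \<open>I\<close> is close to
  \<open>(card I)\<^sup>2 w 0\<close>. On the other hand it is at most \<open>card I\<close> times the supremum of the exponential
  sums, which is \<open>o(N)\<close>. Since \<open>m\<close> depends only on \<open>w\<close> and the tolerance, \<open>w 0\<close> must be \<open>0\<close>.\<close>

lemma almost_periodic_eq_0_if_means_0:
  assumes v: "almost_periodic v" and mean: "\<And>x. has_mean (\<lambda>t. v t * cis (x * t)) 0"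
  shows "v t\<^sub>0 = 0"
proof -
  define w where "w = (\<lambda>t. v (t + t\<^sub>0))"
  have w: "almost_periodic w" unfolding w_def by (rule almost_periodic_translate[OF v])
  have wmean: "has_mean (\<lambda>t. w t * cis (x * t)) 0" for x
  proof -
    have "has_mean (\<lambda>t. cis (- x * t\<^sub>0) * (v (t + t\<^sub>0) * cis (x * (t + t\<^sub>0)))) (cis (- x * t\<^sub>0) * 0)"
      using almost_periodic_continuous[OF v]
      by (intro has_mean_cmult has_mean_translate[where g = "\<lambda>t. v t * cis (x * t)"] mean continuous_intros)
    moreover have "cis (- x * t\<^sub>0) * (v (t + t\<^sub>0) * cis (x * (t + t\<^sub>0))) = w t * cis (x * t)" for t
    proof -
      have "cis (- x * t\<^sub>0) * cis (x * (t + t\<^sub>0)) = cis (x * t)"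
        by (simp add: cis_mult algebra_simps)
      then show ?thesis by (simp add: w_def mult.left_commute)
    qed
    ultimately show ?thesis by simp
  qed
  have "norm (w 0) \<le> 0"
  proof (rule field_le_epsilon)
    fix e' :: real assume "e' > 0"
    define e where "e = e' / 3"
    have "e > 0" using \<open>e' > 0\<close> by (simp add: e_def)
    obtain A where A: "finite A" "\<And>a. \<exists>b\<in>A. \<forall>x. norm (w (x + a) - w (x + b)) \<le> e"
      using almost_periodic_net[OF w \<open>e > 0\<close>] by blast
    have "A \<noteq> {}" using A(2) by blast
    define m where "m = card A"
    have "m > 0" using A(1) \<open>A \<noteq> {}\<close> by (simp add: m_def card_gt_0_iff)
    then have "e / real m > 0" using \<open>e > 0\<close> by simp
    then obtain h N where "h > 0" "N \<ge> (1::nat)" and hN: "\<And>\<xi>. \<bar>\<xi>\<bar> \<le> pi \<Longrightarrow>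
       norm (\<Sum>n\<in>{-int N..<int N}. w (h * of_int n) * cis (- \<xi> * of_int n)) \<le> e / real m * real N"
      using sample_sums_small[OF w wmean] by blast
    have "\<exists>b\<in>A. \<forall>x. norm (w (x + h * of_int i) - w (x + b)) \<le> e" for i :: int
      using A(2) .
    then have "\<forall>i. \<exists>b. b \<in> A \<and> (\<forall>x. norm (w (x + h * of_int i) - w (x + b)) \<le> e)" by blast
    from choice[OF this] obtain c :: "int \<Rightarrow> real"
      where c: "\<And>i. c i \<in> A" "\<And>i x. norm (w (x + h * of_int i) - w (x + c i)) \<le> e"
      by blast
    have "\<exists>b\<in>A. real N \<le> real m * real (card {i\<in>{0..<int N}. c i = b})"
    proof (rule ccontr)
      assume "\<not> ?thesis"
      then have *: "real m * real (card {i\<in>{0..<int N}. c i = b}) < real N" if "b \<in> A" for b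
        using that by (meson not_le)
      have "{0..<int N} = (\<Union>b\<in>A. {i\<in>{0..<int N}. c i = b})" using c(1) by auto
      then have "card {0..<int N} \<le> (\<Sum>b\<in>A. card {i\<in>{0..<int N}. c i = b})"
        using card_UN_le[OF A(1), of "\<lambda>b. {i\<in>{0..<int N}. c i = b}"] by (simp only:)
      then have "real N \<le> real (\<Sum>b\<in>A. card {i\<in>{0..<int N}. c i = b})"
        by (simp only: card_atLeastLessThan_int diff_zero nat_int of_nat_le_iff)
      then have "real m * real N \<le> (\<Sum>b\<in>A. real m * real (card {i\<in>{0..<int N}. c i = b}))"
        unfolding sum_distrib_left[symmetric] of_nat_sum[symmetric] by (rule mult_left_mono) simp
      also have "\<dots> < (\<Sum>b\<in>A. real N)" using * A(1) \<open>A \<noteq> {}\<close> by (intro sum_strict_mono) auto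
      also have "\<dots> = real m * real N" by (simp add: m_def)
      finally show False by simp
    qed
    then obtain b where b: "b \<in> A" "real N \<le> real m * real (card {i\<in>{0..<int N}. c i = b})"
      by blast
    define I where "I = {i\<in>{0..<int N}. c i = b}"
    have fin: "finite I" unfolding I_def by (rule finite_subset[of _ "{0..<int N}"]) auto
    have cardI: "real N \<le> real m * real (card I)" using b(2) by (simp add: I_def)
    then have "card I > 0" using \<open>N \<ge> 1\<close> by (cases "card I") auto
    have close: "norm (w 0 - w (h * of_int (j - i))) \<le> 2 * e" if "i \<in> I" "j \<in> I" for i j
    proof -
      have "norm (w (- (h * of_int i) + h * of_int i) - w (- (h * of_int i) + c i)) \<le> e"
           "norm (w (- (h * of_int i) + h * of_int j) - w (- (h * of_int i) + c j)) \<le> e"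
        by (rule c(2))+
      moreover have "- (h * of_int i) + h * of_int i = 0" "- (h * of_int i) + h * of_int j = h * of_int (j - i)"
          "c i = b" "c j = b"
        using that by (auto simp: I_def algebra_simps)
      ultimately have "dist (w 0) (w (- (h * of_int i) + b)) \<le> e"
        "dist (w (h * of_int (j - i))) (w (- (h * of_int i) + b)) \<le> e"
        unfolding dist_norm by (simp_all only:)
      then show ?thesis
        using dist_triangle2[of "w 0" "w (h * of_int (j - i))" "w (- (h * of_int i) + b)"]
        by (simp add: dist_norm)
    qed
    have "of_nat (card I) * (of_nat (card I) * w 0) = (\<Sum>j\<in>I. \<Sum>i\<in>I. w 0 - w (h * of_int (j - i)))
        + (\<Sum>j\<in>I. \<Sum>i\<in>I. w (h * of_int (j - i)))"
      by (simp add: sum_subtractf)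
    also have "norm \<dots> \<le> real (card I) * (real (card I) * (2 * e)) + e / real m * real N * real (card I)"
    proof (intro norm_triangle_mono)
      have "norm (\<Sum>j\<in>I. \<Sum>i\<in>I. w 0 - w (h * of_int (j - i))) \<le> (\<Sum>j\<in>I. \<Sum>i\<in>I. 2 * e)"
        by (intro sum_norm_le close)
      then show "norm (\<Sum>j\<in>I. \<Sum>i\<in>I. w 0 - w (h * of_int (j - i))) \<le> real (card I) * (real (card I) * (2 * e))"
        by simp
      show "norm (\<Sum>j\<in>I. \<Sum>i\<in>I. w (h * of_int (j - i))) \<le> e / real m * real N * real (card I)"
        using hN by (intro toeplitz_form_bound[where v = "\<lambda>n. w (h * of_int n)" and N = N]) (auto simp: I_def)
    qed
    also have "\<dots> \<le> real (card I) * (real (card I) * (2 * e)) + e / real m * (real m * real (card I)) * real (card I)"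
      using cardI \<open>e > 0\<close> by (intro add_left_mono mult_right_mono mult_left_mono) auto
    also have "\<dots> = real (card I) * (real (card I) * e')"
      using \<open>m > 0\<close> by (simp add: e_def)
    finally show "norm (w 0) \<le> 0 + e'"
      using \<open>card I > 0\<close> by (simp add: norm_mult)
  qed
  then show ?thesis by (simp add: w_def)
qed

section \<open>Fejer's kernel and convolutions\<close>

definition fejer_mass :: real where
  "fejer_mass = (LBINT w. (1 - cos w) / w\<^sup>2)"

text \<open>Only two properties of the kernel matter: it is a probability density, and its Fourier transform
  vanishes outside \<open>{-1<..<1}\<close>. So the mass stays an unevaluated constant (its value is \<open>pi\<close>).\<close>

definition fejer :: "real \<Rightarrow> real" where
  "fejer w = (1 - cos w) / w\<^sup>2 / fejer_mass"

lemma integrable_one_minus_cos: "integrable lborel (\<lambda>w::real. (1 - cos w) / w\<^sup>2)"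
proof (rule Bochner_Integration.integrable_bound)
  have "integrable lborel (\<lambda>w::real. inverse (1 + w\<^sup>2))"
    using integrable_inverse_1_plus_square by (simp add: set_integrable_def einterval_def)
  then show "integrable lborel (\<lambda>w::real. 4 * inverse (1 + w\<^sup>2))" by simp
  show "AE w::real in lborel. norm ((1 - cos w) / w\<^sup>2) \<le> norm (4 * inverse (1 + w\<^sup>2))"
  proof (intro AE_I2)
    fix w :: real
    have half: "1 - cos w = 2 * (sin (w / 2))\<^sup>2" using cos_double_sin[of "w / 2"] by simp
    have "(sin (w / 2))\<^sup>2 \<le> (w / 2)\<^sup>2"
      using abs_sin_x_le_abs_x[of "w / 2"] by (simp only: abs_le_square_iff)
    then have "(sin (w / 2))\<^sup>2 \<le> w\<^sup>2 / 4" by (simp add: power_divide)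
    moreover have "(sin (w / 2))\<^sup>2 \<le> 1" by (simp add: abs_square_le_1)
    then have "(sin (w / 2))\<^sup>2 * w\<^sup>2 \<le> 1 * w\<^sup>2" by (rule mult_right_mono) simp
    ultimately have "(1 - cos w) * (1 + w\<^sup>2) \<le> 4 * w\<^sup>2"
      unfolding half distrib_left mult_1_right mult.assoc using zero_le_power2[of w] by linarith
    then have "(1 - cos w) / w\<^sup>2 \<le> 4 * inverse (1 + w\<^sup>2)"
      by (cases "w = 0") (auto simp: field_simps add_pos_nonneg)
    then show "norm ((1 - cos w) / w\<^sup>2) \<le> norm (4 * inverse (1 + w\<^sup>2))"
      by (simp add: add_nonneg_nonneg)
  qed
qed simp

text \<open>Rescaling the variable produces the factor \<open>\<bar>a\<bar>\<close>; the piecewise linear Fourier transform of the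
  kernel comes from this factor alone.\<close>

lemma integral_one_minus_cos_scaled:
  "integrable lborel (\<lambda>w::real. (1 - cos (a * w)) / w\<^sup>2)"
  "(LBINT w. (1 - cos (a * w)) / w\<^sup>2) = \<bar>a\<bar> * fejer_mass"
proof -
  define g where "g = (\<lambda>w::real. (1 - cos w) / w\<^sup>2)"
  have eq: "(1 - cos (a * w)) / w\<^sup>2 = a\<^sup>2 * g (0 + a * w)" if "a \<noteq> 0" for w
    using that by (simp add: g_def power_mult_distrib)
  have g: "integrable lborel g" unfolding g_def by (rule integrable_one_minus_cos)
  show "integrable lborel (\<lambda>w::real. (1 - cos (a * w)) / w\<^sup>2)"
  proof (cases "a = 0")
    case False
    show ?thesis
      unfolding eq[OF False] by (intro integrable_mult_right lborel_integrable_real_affine g False)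
  qed simp
  show "(LBINT w. (1 - cos (a * w)) / w\<^sup>2) = \<bar>a\<bar> * fejer_mass"
  proof (cases "a = 0")
    case False
    have "fejer_mass = \<bar>a\<bar> * (LBINT w. g (0 + a * w))"
      using lborel_integral_real_affine[OF False, of g 0] by (simp add: fejer_mass_def g_def)
    then have "\<bar>a\<bar> * fejer_mass = a\<^sup>2 * (LBINT w. g (0 + a * w))"
      by (metis abs_mult_self_eq mult.assoc power2_eq_square)
    then show ?thesis unfolding eq[OF False] integral_mult_right_zero by (rule sym)
  qed simp
qed

lemma fejer_mass_pos: "fejer_mass > 0"
proof -
  have "0 < (1 - cos 1) / (4::real)" using cos_monotone_0_pi[of 0 1] pi_gt3 by simp
  also have "\<dots> = (LBINT w::real. indicator {1..2} w *\<^sub>R ((1 - cos 1) / (4::real)))" by simp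
  also have "\<dots> \<le> fejer_mass"
    unfolding fejer_mass_def
  proof (rule integral_mono)
    show "integrable lborel (\<lambda>w::real. indicator {1..2} w *\<^sub>R ((1 - cos 1) / (4::real)))" 
      by (intro integrable_scaleR_left integrable_real_indicator) auto
    show "integrable lborel (\<lambda>w::real. (1 - cos w) / w\<^sup>2)" by (rule integrable_one_minus_cos)
    fix w :: real
    show "indicator {1..2} w *\<^sub>R ((1 - cos 1) / 4) \<le> (1 - cos w) / w\<^sup>2"
    proof (cases "w \<in> {1..2}")
      case True
      then have "cos w \<le> cos 1" using pi_gt3 by (intro cos_monotone_0_pi_le) auto
      moreover have "w\<^sup>2 \<le> 4" "w\<^sup>2 > 0" using True power_mono[of w 2 2] by auto
      ultimately have "(1 - cos 1) / 4 \<le> (1 - cos w) / w\<^sup>2" by (intro frac_le) auto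
      then show ?thesis using True by simp
    qed simp
  qed
  finally show ?thesis .
qed

lemma fejer_nonneg: "fejer w \<ge> 0"
  using fejer_mass_pos by (simp add: fejer_def)

lemma integrable_fejer: "integrable lborel fejer"
  unfolding fejer_def[abs_def] by (intro integrable_divide_zero integrable_one_minus_cos)

lemma fejer_measurable [measurable]: "fejer \<in> borel_measurable borel"
  unfolding fejer_def[abs_def] by measurable

lemma integral_fejer: "(LBINT w. fejer w) = 1"
proof -
  have "(LBINT w. fejer w) = (LBINT w. (1 - cos w) / w\<^sup>2) / fejer_mass"
    unfolding fejer_def by (rule integral_divide_zero)
  then show ?thesis using fejer_mass_pos by (simp add: fejer_mass_def)
qed

text \<open>By the addition theorem the cosine transform is
  \<open>\<bar>b + 1\<bar> / 2 + \<bar>b - 1\<bar> / 2 - \<bar>b\<bar>\<close>, which vanishes for \<open>\<bar>b\<bar> \<ge> 1\<close>; the sine transform vanishes by parity.\<close>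

lemma fejer_fourier_zero:
  assumes "\<bar>b\<bar> \<ge> 1"
  shows "(LBINT w. of_real (fejer w) * cis (b * w)) = 0"
proof -
  have int: "integrable lborel (\<lambda>w. of_real (fejer w) * cis (b * w))"
  proof (rule Bochner_Integration.integrable_bound[OF integrable_fejer])
    show "(\<lambda>w. of_real (fejer w) * cis (b * w)) \<in> borel_measurable lborel"
      unfolding cis_conv_exp by measurable
  qed (simp add: norm_mult)
  have "(LBINT w. fejer w * cos (b * w)) = 0"
  proof -
    let ?g = "\<lambda>a w::real. (1 - cos (a * w)) / w\<^sup>2"
    have prod: "(1 - p) * q = (1 - r) / 2 + (1 - s) / 2 - (1 - q)" if "r + s = 2 * q * p" for p q r s :: real
      using that by (simp add: field_simps)
    have "fejer w * cos (b * w) = (?g (b + 1) w / 2 + ?g (b - 1) w / 2 - ?g b w) / fejer_mass" for w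
    proof -
      have "cos ((b + 1) * w) + cos ((b - 1) * w) = 2 * cos (b * w) * cos w"
        by (simp add: algebra_simps cos_add cos_diff)
      then have "(1 - cos w) * cos (b * w) = (1 - cos ((b + 1) * w)) / 2 + (1 - cos ((b - 1) * w)) / 2 - (1 - cos (b * w))"
        using prod by blast
      then have "(1 - cos w) * cos (b * w) / w\<^sup>2 = ?g (b + 1) w / 2 + ?g (b - 1) w / 2 - ?g b w"
        by (simp only: add_divide_distrib diff_divide_distrib) (simp add: diff_divide_distrib)
      then show ?thesis by (simp only: fejer_def times_divide_eq_left)
    qed
    then have "(LBINT w. fejer w * cos (b * w))
        = (LBINT w. (?g (b + 1) w / 2 + ?g (b - 1) w / 2 - ?g b w) / fejer_mass)" by presburger
    also have "\<dots> = ((LBINT w. ?g (b + 1) w) / 2 + (LBINT w. ?g (b - 1) w) / 2 - (LBINT w. ?g b w)) / fejer_mass"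
      by (simp only: integral_divide_zero Bochner_Integration.integral_diff Bochner_Integration.integral_add
          integrable_divide_zero Bochner_Integration.integrable_add integral_one_minus_cos_scaled(1) simp_thms)
    also have "\<dots> = \<bar>b + 1\<bar> / 2 + \<bar>b - 1\<bar> / 2 - \<bar>b\<bar>"
      unfolding integral_one_minus_cos_scaled(2) using fejer_mass_pos by (simp add: field_simps)
    also have "\<dots> = 0" using assms by (auto simp: abs_if field_simps split: if_splits)
    finally show ?thesis .
  qed
  moreover have "(LBINT w. fejer w * sin (b * w)) = 0"
  proof -
    have "(LBINT w. fejer w * sin (b * w)) = (LBINT w. fejer (0 + (-1) * w) * sin (b * (0 + (-1) * w)))"
      using lborel_integral_real_affine[of "-1" "\<lambda>w. fejer w * sin (b * w)" 0] by simp
    also have "\<dots> = - (LBINT w. fejer w * sin (b * w))"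
      by (simp add: fejer_def)
    finally show ?thesis by simp
  qed
  ultimately show ?thesis
    using integral_Re[OF int] integral_Im[OF int] by (intro complex_eqI) simp_all
qed

lemma integrable_kernel_mult:
  fixes k :: "real \<Rightarrow> real" and u :: "real \<Rightarrow> complex"
  assumes "integrable lborel k" "u \<in> borel_measurable borel" "\<And>t. norm (u t) \<le> C"
  shows "integrable lborel (\<lambda>w. of_real (k w) * u w)"
proof (rule Bochner_Integration.integrable_bound)
  show "integrable lborel (\<lambda>w. C * k w)" using assms(1) by simp
  show "(\<lambda>w. of_real (k w) * u w) \<in> borel_measurable lborel"
    using assms(2) borel_measurable_integrable[OF assms(1)] by measurable
  have "C \<ge> 0" using assms(3)[of 0] norm_ge_zero order_trans by blast
  then show "AE w in lborel. norm (of_real (k w) * u w) \<le> norm (C * k w)"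
    using assms(3) by (auto simp: norm_mult abs_mult mult.commute[of C] intro!: mult_left_mono AE_I2)
qed

lemma integrable_kernel_almost_periodic:
  assumes "integrable lborel k" "almost_periodic u"
  shows "integrable lborel (\<lambda>w. of_real (k w) * u (t + c * w))"
proof -
  obtain C where C: "\<And>x. norm (u x) \<le> C" using almost_periodic_bounded[OF assms(2)] by blast
  have "(\<lambda>w. u (t + c * w)) \<in> borel_measurable borel"
    by (intro borel_measurable_continuous_onI continuous_on_compose2[OF almost_periodic_continuous[OF assms(2), of UNIV]]
        continuous_intros) auto
  then show ?thesis using assms(1) C by (intro integrable_kernel_mult) auto
qed

text \<open>A convolution depends on \<open>u\<close> linearly, boundedly and compatibly with translation, so a net of
  translates of \<open>u\<close> is also a net for the convolution.\<close>

lemma almost_periodic_convolution: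
  assumes k: "integrable lborel k" and u: "almost_periodic u"
  shows "almost_periodic (\<lambda>t. LBINT w. of_real (k w) * u (t + c * w))"
proof -
  \<comment> \<open>the summand 1 allows division by K even if k vanishes almost everywhere\<close>
  define K where "K = (LBINT w. \<bar>k w\<bar>) + 1"
  have "K > 0" unfolding K_def by (simp add: add_nonneg_pos)
  have bound: "norm ((LBINT w. of_real (k w) * u (t + c * w)) - (LBINT w. of_real (k w) * u (t' + c * w))) \<le> K * e"
    if e: "e > 0" "\<And>x. norm (u (x + t) - u (x + t')) \<le> e" for t t' e
  proof -
    have "(LBINT w. of_real (k w) * u (t + c * w)) - (LBINT w. of_real (k w) * u (t' + c * w))
        = (LBINT w. of_real (k w) * u (t + c * w) - of_real (k w) * u (t' + c * w))"
      by (rule Bochner_Integration.integral_diff[symmetric]; rule integrable_kernel_almost_periodic[OF k u])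
    also have "norm \<dots> \<le> (LBINT w. \<bar>k w\<bar> * e)"
    proof (rule Bochner_Integration.integral_norm_bound_integral)
      show "integrable lborel (\<lambda>w. of_real (k w) * u (t + c * w) - of_real (k w) * u (t' + c * w))"
        by (rule Bochner_Integration.integrable_diff; rule integrable_kernel_almost_periodic[OF k u])
      show "integrable lborel (\<lambda>w. \<bar>k w\<bar> * e)" using k by simp
      show "norm (of_real (k w) * u (t + c * w) - of_real (k w) * u (t' + c * w)) \<le> \<bar>k w\<bar> * e" for w
        using e(2)[of "c * w"] by (simp add: norm_mult add.commute mult_left_mono flip: right_diff_distrib)
    qed
    also have "\<dots> \<le> K * e" using e(1) by (simp add: K_def)
    finally show ?thesis .
  qed
  show ?thesis
    unfolding almost_periodic_def
  proof (intro conjI allI impI)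
    show "continuous_on UNIV (\<lambda>t. LBINT w. of_real (k w) * u (t + c * w))"
      unfolding continuous_on_iff
    proof (intro ballI allI impI)
      fix t e :: real assume "e > 0"
      then have "e / (2 * K) > 0" using \<open>K > 0\<close> by simp
      then obtain d where "d > 0" and d: "\<And>x y. dist y x < d \<Longrightarrow> dist (u y) (u x) < e / (2 * K)"
        using almost_periodic_uniformly_continuous[OF u] unfolding uniformly_continuous_on_def by (metis UNIV_I)
      show "\<exists>d>0. \<forall>t'\<in>UNIV. dist t' t < d \<longrightarrow>
        dist (LBINT w. of_real (k w) * u (t' + c * w)) (LBINT w. of_real (k w) * u (t + c * w)) < e"
      proof (intro exI[of _ d] conjI ballI impI)
        fix t' assume "dist t' t < d"
        then have "dist (u (x + t')) (u (x + t)) < e / (2 * K)" for x by (intro d) (simp add: dist_real_def)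
        then have "dist (LBINT w. of_real (k w) * u (t' + c * w)) (LBINT w. of_real (k w) * u (t + c * w)) \<le> K * (e / (2 * K))"
          unfolding dist_norm using \<open>e / (2 * K) > 0\<close> by (intro bound) (auto intro: less_imp_le)
        also have "\<dots> < e" using \<open>K > 0\<close> \<open>e > 0\<close> by simp
        finally show "dist (LBINT w. of_real (k w) * u (t' + c * w)) (LBINT w. of_real (k w) * u (t + c * w)) < e" .
      qed (rule \<open>d > 0\<close>)
    qed
  next
    fix e :: real assume "e > 0"
    then have "e / K > 0" using \<open>K > 0\<close> by simp
    then obtain A where A: "finite A" "\<And>a. \<exists>b\<in>A. \<forall>x. norm (u (x + a) - u (x + b)) \<le> e / K"
      using almost_periodic_net[OF u] by blast
    have "\<exists>b\<in>A. \<forall>x. norm ((LBINT w. of_real (k w) * u (x + a + c * w)) - (LBINT w. of_real (k w) * u (x + b + c * w))) \<le> e" for a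
    proof -
      obtain b where b: "b \<in> A" "\<And>x. norm (u (x + a) - u (x + b)) \<le> e / K" using A(2) by blast
      have "norm ((LBINT w. of_real (k w) * u (x + a + c * w)) - (LBINT w. of_real (k w) * u (x + b + c * w))) \<le> K * (e / K)" for x
        using b(2)[of "_ + x"] \<open>e / K > 0\<close> by (intro bound) (auto simp: add.assoc)
      then show ?thesis using b(1) \<open>K > 0\<close> by auto
    qed
    then show "\<exists>A. finite A \<and> (\<forall>a. \<exists>b\<in>A. \<forall>x. norm ((LBINT w. of_real (k w) * u (x + a + c * w)) - (LBINT w. of_real (k w) * u (x + b + c * w))) \<le> e)"
      using A(1) by blast
  qed
qed

text \<open>Convolution multiplies Fourier coefficients by the Fourier transform of the kernel. Fubini turns
  the window average of the convolution into an average of window averages of translates of \<open>u\<close>;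
  these converge by translation invariance, and dominated convergence applies.\<close>

lemma has_mean_convolution:
  assumes k: "integrable lborel k" and u: "almost_periodic u" and m: "has_mean (\<lambda>t. u t * cis (x * t)) m"
  shows "has_mean (\<lambda>t. (LBINT w. of_real (k w) * u (t + c * w)) * cis (x * t))
           (m * (LBINT w. of_real (k w) * cis (- x * c * w)))"
proof -
  obtain C where C: "C > 0" "\<And>x. norm (u x) \<le> C" using almost_periodic_bounded[OF u] by blast
  have cont: "continuous_on UNIV u" by (rule almost_periodic_continuous[OF u])
  have [measurable]: "u \<in> borel_measurable borel" by (rule borel_measurable_continuous_onI[OF cont])
  have [measurable]: "k \<in> borel_measurable borel" using borel_measurable_integrable[OF k] by simp
  have [measurable]: "(cis :: real \<Rightarrow> complex) \<in> borel_measurable borel"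
    by (intro borel_measurable_continuous_onI continuous_intros)
  define v where "v = (\<lambda>t. LBINT w. of_real (k w) * u (t + c * w))"
  have v: "almost_periodic v" unfolding v_def by (rule almost_periodic_convolution[OF k u])
  obtain m' where m': "has_mean (\<lambda>t. v t * cis (x * t)) m'"
    using almost_periodic_has_mean[OF almost_periodic_mult[OF v almost_periodic_cis]] by blast
  define G where "G = (\<lambda>T w t. indicator {-T..T} t *\<^sub>R (u (t + c * w) * cis (x * t)) :: complex)"
  have [measurable]: "(\<lambda>(w, t). G T w t) \<in> borel_measurable (borel \<Otimes>\<^sub>M borel)" for T
    unfolding G_def by measurable
  have hk: "integral {-T..T} g = (LBINT t. indicator {-T..T} t *\<^sub>R g t)" if "continuous_on UNIV g"
    for T and g :: "real \<Rightarrow> complex"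
    using set_borel_integral_eq_integral(2)[of "{-T..T}" g] borel_integrable_atLeastAtMost'[of "-T" T g]
      continuous_on_subset[OF that]
    by (simp add: set_lebesgue_integral_def)
  have G: "(LBINT t. G T w t) = integral {-T..T} (\<lambda>t. u (t + c * w) * cis (x * t))" for T w
    unfolding G_def by (intro hk[symmetric] continuous_intros continuous_on_compose2[OF cont]) auto
  have G_int: "integrable lborel (G T w)" for T w
    unfolding G_def set_integrable_def[symmetric]
    by (intro borel_integrable_atLeastAtMost' continuous_intros continuous_on_compose2[OF cont]) auto
  have G_norm: "norm (G T w t) \<le> C * indicator {-T..T} t" for T w t
    using C by (auto simp: G_def norm_mult indicator_def)
  have ind_int: "integrable lborel (\<lambda>t. C * indicator {-T..T} t :: real)" for T :: real
    by (intro integrable_mult_right integrable_real_indicator) (auto simp: emeasure_lborel_Icc_eq)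
  have swap: "integral {-T..T} (\<lambda>t. v t * cis (x * t)) = (LBINT w. of_real (k w) * (LBINT t. G T w t))" for T
  proof -
    have int: "integrable (lborel \<Otimes>\<^sub>M lborel) (\<lambda>(w, t). of_real (k w) * G T w t)"
    proof (rule lborel_pair.Fubini_integrable)
      show "(\<lambda>(w, t). of_real (k w) * G T w t) \<in> borel_measurable (lborel \<Otimes>\<^sub>M lborel)" by measurable
      show "integrable lborel (\<lambda>w. LBINT t. norm (case (w, t) of (w, t) \<Rightarrow> of_real (k w) * G T w t))"
      proof (rule Bochner_Integration.integrable_bound)
        show "integrable lborel (\<lambda>w. \<bar>k w\<bar> * (LBINT t. C * indicator {-T..T} t))" using k by simp
        show "AE w in lborel. norm (LBINT t. norm (case (w, t) of (w, t) \<Rightarrow> of_real (k w) * G T w t))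
          \<le> norm (\<bar>k w\<bar> * (LBINT t. C * indicator {-T..T} t))"
        proof (intro AE_I2)
          fix w
          let ?A = "LBINT t. norm (G T w t)" and ?B = "LBINT t. C * indicator {-T..T} t"
          have "?A \<le> ?B" by (rule integral_mono[OF integrable_norm[OF G_int] ind_int G_norm])
          then have le: "\<bar>k w\<bar> * ?A \<le> \<bar>k w\<bar> * ?B" by (rule mult_left_mono[OF _ abs_ge_zero])
          have "?A \<ge> 0" by (rule Bochner_Integration.integral_nonneg) simp
          then have "0 \<le> \<bar>k w\<bar> * ?A" by (rule mult_nonneg_nonneg[OF abs_ge_zero])
          moreover have "0 \<le> \<bar>k w\<bar> * ?B" using calculation le by (rule order_trans)
          moreover have "(LBINT t. norm (case (w, t) of (w, t) \<Rightarrow> of_real (k w) * G T w t)) = \<bar>k w\<bar> * ?A"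
            by (simp add: norm_mult)
          ultimately show "norm (LBINT t. norm (case (w, t) of (w, t) \<Rightarrow> of_real (k w) * G T w t))
            \<le> norm (\<bar>k w\<bar> * ?B)"
            using le by (simp only: real_norm_def abs_of_nonneg)
        qed
      qed measurable
      show "AE w in lborel. integrable lborel (\<lambda>t. case (w, t) of (w, t) \<Rightarrow> of_real (k w) * G T w t)"
        using G_int by simp
    qed
    have "integral {-T..T} (\<lambda>t. v t * cis (x * t)) = (LBINT t. indicator {-T..T} t *\<^sub>R (v t * cis (x * t)))"
      by (intro hk continuous_intros almost_periodic_continuous[OF v])
    also have "\<dots> = (LBINT t. LBINT w. of_real (k w) * G T w t)"
    proof (rule Bochner_Integration.integral_cong[OF refl])
      fix t
      have "indicator {-T..T} t *\<^sub>R (v t * cis (x * t))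
          = (LBINT w. of_real (k w) * u (t + c * w)) * (indicator {-T..T} t *\<^sub>R cis (x * t))"
        by (simp add: v_def)
      also have "\<dots> = (LBINT w. of_real (k w) * u (t + c * w) * (indicator {-T..T} t *\<^sub>R cis (x * t)))"
        by (rule integral_mult_left_zero[symmetric])
      also have "\<dots> = (LBINT w. of_real (k w) * G T w t)"
        by (simp add: G_def mult_ac)
      finally show "indicator {-T..T} t *\<^sub>R (v t * cis (x * t)) = (LBINT w. of_real (k w) * G T w t)" .
    qed
    also have "\<dots> = (LBINT w. LBINT t. of_real (k w) * G T w t)"
      using lborel_pair.Fubini_integral[OF int] by simp
    finally show ?thesis by simp
  qed
  have "((\<lambda>T. LBINT w. of_real (k w) * ((LBINT t. G T w t) / of_real (2 * T))) \<longlongrightarrow>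
      (LBINT w. of_real (k w) * (cis (- x * c * w) * m))) at_top"
  proof (rule integral_dominated_convergence_at_top[where w = "\<lambda>w. \<bar>k w\<bar> * C"])
    show "(\<lambda>w. of_real (k w) * (cis (- x * c * w) * m)) \<in> borel_measurable lborel" by measurable
    show "(\<lambda>w. of_real (k w) * ((LBINT t. G T w t) / of_real (2 * T))) \<in> borel_measurable lborel" for T
      by measurable
    show "integrable lborel (\<lambda>w. \<bar>k w\<bar> * C)" using k by simp
    have lim: "((\<lambda>T. (LBINT t. G T w t) / of_real (2 * T)) \<longlongrightarrow> cis (- x * c * w) * m) at_top" for w
    proof -
      have "has_mean (\<lambda>t. cis (- x * c * w) * (u (t + c * w) * cis (x * (t + c * w)))) (cis (- x * c * w) * m)"
        by (intro has_mean_cmult has_mean_translate[where g = "\<lambda>t. u t * cis (x * t)"] m continuous_intros cont)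
      moreover have "cis (- x * c * w) * (u (t + c * w) * cis (x * (t + c * w))) = u (t + c * w) * cis (x * t)" for t
      proof -
        have "cis (- x * c * w) * cis (x * (t + c * w)) = cis (x * t)" by (simp add: cis_mult algebra_simps)
        then show ?thesis by (simp add: mult.left_commute)
      qed
      ultimately show ?thesis unfolding G by (intro has_mean_symmetric) (simp only:)
    qed
    show "AE w in lborel. ((\<lambda>T. of_real (k w) * ((LBINT t. G T w t) / of_real (2 * T))) \<longlongrightarrow>
        of_real (k w) * (cis (- x * c * w) * m)) at_top"
      by (intro AE_I2 tendsto_mult_left lim)
    show "\<forall>\<^sub>F T in at_top. AE w in lborel. norm (of_real (k w) * ((LBINT t. G T w t) / of_real (2 * T))) \<le> \<bar>k w\<bar> * C"
      using eventually_gt_at_top[of 0]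
    proof eventually_elim
      case (elim T)
      show ?case
      proof (intro AE_I2)
        fix w
        have "norm (LBINT t. G T w t) \<le> C * (T - - T)"
          unfolding G using elim C
          by (intro window_bound continuous_intros continuous_on_compose2[OF cont]) (auto simp: norm_mult)
        then have "norm (LBINT t. G T w t) / (2 * T) \<le> C" using elim by (simp add: field_simps)
        then show "norm (of_real (k w) * ((LBINT t. G T w t) / of_real (2 * T))) \<le> \<bar>k w\<bar> * C"
          using elim by (simp add: norm_mult norm_divide mult_left_mono del: times_divide_eq_right)
      qed
    qed
  qed
  moreover have "(LBINT w. of_real (k w) * ((LBINT t. G T w t) / of_real (2 * T)))
      = integral {-T..T} (\<lambda>t. v t * cis (x * t)) / of_real (2 * T)" for T
    unfolding swap times_divide_eq_right by (rule integral_divide_zero)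
  moreover have "(LBINT w. of_real (k w) * (cis (- x * c * w) * m)) = m * (LBINT w. of_real (k w) * cis (- x * c * w))"
    by (simp add: mult_ac flip: integral_mult_right_zero)
  ultimately have "((\<lambda>T. integral {-T..T} (\<lambda>t. v t * cis (x * t)) / of_real (2 * T)) \<longlongrightarrow>
      m * (LBINT w. of_real (k w) * cis (- x * c * w))) at_top" by (simp only:)
  then have "m' = m * (LBINT w. of_real (k w) * cis (- x * c * w))"
    by (rule tendsto_unique[OF trivial_limit_at_top_linorder has_mean_symmetric[OF m']])
  then show ?thesis using m' by (simp add: v_def)
qed

section \<open>Bohr coefficients and vertical Fejer means on the half-plane\<close>

text \<open>The ambient space of \<open>H_infty lam\<close>, without the condition on the frequencies.\<close>

definition almost_periodic_holomorphic :: "(complex \<Rightarrow> complex) \<Rightarrow> bool" where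
  "almost_periodic_holomorphic f \<longleftrightarrow> bounded (f ` right_halfplane) \<and> f holomorphic_on right_halfplane \<and>
     uniformly_almost_periodic_halfplane f"

lemma H_infty_iff: "f \<in> H_infty lam \<longleftrightarrow> almost_periodic_holomorphic f \<and> (\<forall>x. x \<notin> range lam \<longrightarrow> bohr_coeff f x = 0)"
  by (simp add: H_infty_def almost_periodic_holomorphic_def)

lemma almost_periodic_holomorphic_line: "almost_periodic_holomorphic f \<Longrightarrow> \<sigma> > 0 \<Longrightarrow> almost_periodic (\<lambda>t. f (Complex \<sigma> t))"
  by (simp add: almost_periodic_holomorphic_def uniformly_almost_periodic_halfplane_def uniformly_almost_periodic_iff)

lemma almost_periodic_holomorphic_bound:
  assumes "almost_periodic_holomorphic f" obtains C where "C > 0" "\<And>s. Re s > 0 \<Longrightarrow> norm (f s) \<le> C"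
  using assms unfolding almost_periodic_holomorphic_def right_halfplane_def bounded_pos by auto

lemma open_right_halfplane: "open right_halfplane"
  unfolding right_halfplane_def by (rule open_halfspace_Re_gt)

lemma convex_right_halfplane: "convex right_halfplane"
  unfolding right_halfplane_def by (rule convex_halfspace_Re_gt)

lemma bohr_mean_line:
  "bohr_mean f x \<sigma> T = of_real (exp (\<sigma> * x)) *
     (integral {-T..T} (\<lambda>t. f (Complex \<sigma> t) * cis (x * t)) / of_real (2 * T))"
proof -
  have "f (Complex \<sigma> t) * exp (Complex \<sigma> t * of_real x)
      = of_real (exp (\<sigma> * x)) * (f (Complex \<sigma> t) * cis (x * t))" for t
    by (simp add: exp_eq_polar mult.commute[of x])
  then show ?thesis
    unfolding bohr_mean_def
    by (simp only: Henstock_Kurzweil_Integration.integral_mult_right times_divide_eq_right)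
qed

text \<open>The integrand has a primitive \<open>G\<close> on the half-plane, so both integrals are differences of values
  of \<open>G\<close> at the ends of the lines. Horizontally, \<open>G\<close> changes by a bounded amount, because its derivative
  is bounded on the strip between the lines.\<close>

lemma line_integral_shift_bound:
  assumes f: "almost_periodic_holomorphic f" and \<sigma>: "\<sigma> > 0" "\<sigma>' > 0"
  obtains B where "\<And>T. T \<ge> 0 \<Longrightarrow>
    norm (integral {-T..T} (\<lambda>t. f (Complex \<sigma> t) * exp (Complex \<sigma> t * of_real x))
        - integral {-T..T} (\<lambda>t. f (Complex \<sigma>' t) * exp (Complex \<sigma>' t * of_real x))) \<le> B"
proof -
  obtain C where C: "C > 0" "\<And>s. Re s > 0 \<Longrightarrow> norm (f s) \<le> C" using almost_periodic_holomorphic_bound[OF f] by blast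
  define g where "g = (\<lambda>s. f s * exp (s * of_real x))"
  have "g holomorphic_on right_halfplane"
    unfolding g_def using f by (auto simp: almost_periodic_holomorphic_def intro!: holomorphic_intros)
  then obtain G where G: "\<And>s. s \<in> right_halfplane \<Longrightarrow> (G has_field_derivative g s) (at s within right_halfplane)"
    using holomorphic_convex_primitive'[OF convex_right_halfplane open_right_halfplane] by blast
  then have G: "(G has_field_derivative g s) (at s)" if "Re s > 0" for s
  proof -
    have "s \<in> right_halfplane" using that by (simp add: right_halfplane_def)
    then show ?thesis using G[of s] by (simp only: at_within_open[OF _ open_right_halfplane])
  qed
  have line: "integral {-T..T} (\<lambda>t. g (Complex \<rho> t)) = - \<i> * (G (Complex \<rho> T) - G (Complex \<rho> (-T)))"
    if "\<rho> > 0" "T \<ge> 0" for \<rho> T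
  proof -
    have "((\<lambda>t. g (Complex \<rho> t)) has_integral (- \<i> * G (Complex \<rho> T) - (- \<i> * G (Complex \<rho> (-T))))) {-T..T}"
    proof (intro fundamental_theorem_of_calculus)
      fix t
      have "((\<lambda>z. - \<i> * G (of_real \<rho> + \<i> * z)) has_field_derivative - \<i> * (g (of_real \<rho> + \<i> * of_real t) * \<i>)) (at (of_real t))"
        using that by (auto intro!: derivative_eq_intros DERIV_chain2[OF G])
      from has_vector_derivative_real_field[OF this]
      show "((\<lambda>t. - \<i> * G (Complex \<rho> t)) has_vector_derivative g (Complex \<rho> t)) (at t within {-T..T})"
        by (simp add: Complex_eq mult_ac)
    qed (use that in auto)
    then show ?thesis by (simp add: integral_unique algebra_simps)
  qed
  define M where "M = max \<sigma> \<sigma>'"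
  define S where "S = {s. min \<sigma> \<sigma>' \<le> Re s \<and> Re s \<le> M}"
  define B where "B = C * exp (M * \<bar>x\<bar>)"
  have "convex S"
    unfolding S_def using convex_Int[OF convex_halfspace_Re_ge convex_halfspace_Re_le]
    by (simp add: Collect_conj_eq)
  have S: "Re s > 0" "Re s \<le> M" if "s \<in> S" for s using that \<sigma> by (auto simp: S_def)
  have horizontal: "norm (G (Complex \<sigma> t) - G (Complex \<sigma>' t)) \<le> B * \<bar>\<sigma> - \<sigma>'\<bar>" for t
  proof -
    have "norm (G (Complex \<sigma> t) - G (Complex \<sigma>' t)) \<le> B * norm (Complex \<sigma> t - Complex \<sigma>' t)"
    proof (rule field_differentiable_bound[OF \<open>convex S\<close>])
      show "(G has_field_derivative g z) (at z within S)" if "z \<in> S" for z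
        using G[OF S(1)[OF that]] by (rule has_field_derivative_at_within)
      show "norm (g z) \<le> B" if "z \<in> S" for z
      proof -
        have "Re z * x \<le> Re z * \<bar>x\<bar>" using S[OF that] by (intro mult_left_mono) auto
        also have "\<dots> \<le> M * \<bar>x\<bar>" using S[OF that] by (intro mult_right_mono) auto
        finally show ?thesis
          unfolding g_def B_def norm_mult using C S[OF that] by (intro mult_mono) auto
      qed
    qed (auto simp: S_def M_def)
    then show ?thesis by (simp add: complex_diff cmod_def)
  qed
  show thesis
  proof (rule that[of "2 * (B * \<bar>\<sigma> - \<sigma>'\<bar>)"])
    fix T :: real assume "T \<ge> 0"
    have "integral {-T..T} (\<lambda>t. g (Complex \<sigma> t)) - integral {-T..T} (\<lambda>t. g (Complex \<sigma>' t))
        = - \<i> * ((G (Complex \<sigma> T) - G (Complex \<sigma>' T)) - (G (Complex \<sigma> (-T)) - G (Complex \<sigma>' (-T))))"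
      by (simp only: line[OF \<sigma>(1) \<open>T \<ge> 0\<close>] line[OF \<sigma>(2) \<open>T \<ge> 0\<close>]) (simp add: algebra_simps)
    also have "norm \<dots> \<le> B * \<bar>\<sigma> - \<sigma>'\<bar> + B * \<bar>\<sigma> - \<sigma>'\<bar>"
      unfolding norm_mult norm_minus_cancel norm_ii mult_1_left
      by (rule order_trans[OF norm_triangle_ineq4 add_mono[OF horizontal horizontal]])
    finally show "norm (integral {-T..T} (\<lambda>t. f (Complex \<sigma> t) * exp (Complex \<sigma> t * of_real x))
        - integral {-T..T} (\<lambda>t. f (Complex \<sigma>' t) * exp (Complex \<sigma>' t * of_real x))) \<le> 2 * (B * \<bar>\<sigma> - \<sigma>'\<bar>)"
      by (simp add: g_def)
  qed
qed

lemma bohr_mean_limit_independent: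
  assumes f: "almost_periodic_holomorphic f" and \<sigma>: "\<sigma> > 0" "\<sigma>' > 0" and lim: "(bohr_mean f x \<sigma> \<longlongrightarrow> a) at_top"
  shows "(bohr_mean f x \<sigma>' \<longlongrightarrow> a) at_top"
proof (rule Lim_transform[OF lim])
  obtain B where B: "\<And>T. T \<ge> 0 \<Longrightarrow>
    norm (integral {-T..T} (\<lambda>t. f (Complex \<sigma> t) * exp (Complex \<sigma> t * of_real x))
        - integral {-T..T} (\<lambda>t. f (Complex \<sigma>' t) * exp (Complex \<sigma>' t * of_real x))) \<le> B"
    using line_integral_shift_bound[OF f \<sigma>] by blast
  have "((\<lambda>T. bohr_mean f x \<sigma> T - bohr_mean f x \<sigma>' T) \<longlongrightarrow> 0) at_top"
  proof (rule Lim_null_comparison)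
    show "\<forall>\<^sub>F T in at_top. norm (bohr_mean f x \<sigma> T - bohr_mean f x \<sigma>' T) \<le> B / (2 * T)"
      using eventually_gt_at_top[of 0]
    proof eventually_elim
      case (elim T)
      then show ?case
        using B[of T] unfolding bohr_mean_def diff_divide_distrib[symmetric] norm_divide
        by (auto intro!: divide_right_mono)
    qed
    show "((\<lambda>T. B / (2 * T)) \<longlongrightarrow> 0) at_top"
      by (intro tendsto_divide_0[OF tendsto_const] filterlim_at_top_imp_at_infinity
          filterlim_tendsto_pos_mult_at_top[OF tendsto_const] filterlim_ident) auto
  qed
  from tendsto_minus[OF this]
  show "((\<lambda>T. bohr_mean f x \<sigma>' T - bohr_mean f x \<sigma> T) \<longlongrightarrow> 0) at_top" by simp
qed

text \<open>The description in \<open>bohr_coeff_def\<close> determines a value only once the limits are known to exist on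
  all vertical lines and to agree; all access to Bohr coefficients goes through this rule.\<close>

lemma bohr_coeff_eqI:
  assumes "\<And>\<sigma>. \<sigma> > 0 \<Longrightarrow> (bohr_mean f x \<sigma> \<longlongrightarrow> a) at_top"
  shows "bohr_coeff f x = a"
  unfolding bohr_coeff_def
proof (rule the_equality)
  fix b assume "\<forall>\<sigma>>0. (bohr_mean f x \<sigma> \<longlongrightarrow> b) at_top"
  then have "(bohr_mean f x 1 \<longlongrightarrow> b) at_top" by simp
  then show "b = a" using assms[of 1] tendsto_unique[OF trivial_limit_at_top_linorder] by auto
qed (use assms in auto)

text \<open>On a single vertical line the Fourier coefficients of the almost periodic function are the Bohr
  coefficients damped by \<open>exp (- \<sigma> x)\<close>, so statements about means on the line carry over.\<close>

lemma has_mean_line: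
  assumes f: "almost_periodic_holomorphic f" and "\<sigma> > 0"
  shows "has_mean (\<lambda>t. f (Complex \<sigma> t) * cis (x * t)) (of_real (exp (- \<sigma> * x)) * bohr_coeff f x)"
proof -
  have lim: "(bohr_mean f x \<rho> \<longlongrightarrow> of_real (exp (\<rho> * x)) * m) at_top"
    if "has_mean (\<lambda>t. f (Complex \<rho> t) * cis (x * t)) m" for \<rho> m
    unfolding bohr_mean_line using has_mean_symmetric[OF that] by (intro tendsto_mult_left)
  obtain m where m: "has_mean (\<lambda>t. f (Complex \<sigma> t) * cis (x * t)) m"
    using almost_periodic_has_mean[OF almost_periodic_mult[OF almost_periodic_holomorphic_line[OF assms] almost_periodic_cis]] by blast
  have "bohr_coeff f x = of_real (exp (\<sigma> * x)) * m"
    by (intro bohr_coeff_eqI bohr_mean_limit_independent[OF f \<open>\<sigma> > 0\<close> _ lim[OF m]])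
  then have "of_real (exp (- \<sigma> * x)) * bohr_coeff f x = m"
    by (simp add: exp_minus field_simps)
  then show ?thesis using m by simp
qed

lemma exp_mult_cancel: "of_real (exp (a * x)) * (of_real (exp (- a * x)) * c) = (c :: complex)"
proof -
  have "exp (a * x) * exp (- a * x) = 1" by (simp flip: exp_add)
  then show ?thesis by (simp only: mult.assoc[symmetric] of_real_mult[symmetric]) simp
qed

lemma bohr_coeff_lim:
  assumes "almost_periodic_holomorphic f" "\<sigma> > 0" shows "(bohr_mean f x \<sigma> \<longlongrightarrow> bohr_coeff f x) at_top"
proof -
  have "(bohr_mean f x \<sigma> \<longlongrightarrow> of_real (exp (\<sigma> * x)) * (of_real (exp (- \<sigma> * x)) * bohr_coeff f x)) at_top"
    unfolding bohr_mean_line using has_mean_symmetric[OF has_mean_line[OF assms]] by (intro tendsto_mult_left)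
  then show ?thesis by (simp only: exp_mult_cancel)
qed

lemma bohr_coeff_diff_le:
  assumes "almost_periodic_holomorphic f" "almost_periodic_holomorphic g" "\<And>s. Re s = \<sigma> \<Longrightarrow> norm (f s - g s) \<le> \<delta>" "\<sigma> > 0"
  shows "norm (bohr_coeff f x - bohr_coeff g x) \<le> exp (\<sigma> * x) * \<delta>"
proof -
  have "norm (of_real (exp (- \<sigma> * x)) * bohr_coeff f x - of_real (exp (- \<sigma> * x)) * bohr_coeff g x) \<le> \<delta>"
  proof (rule has_mean_close)
    show "has_mean (\<lambda>t. f (Complex \<sigma> t) * cis (x * t)) (of_real (exp (- \<sigma> * x)) * bohr_coeff f x)"
      "has_mean (\<lambda>t. g (Complex \<sigma> t) * cis (x * t)) (of_real (exp (- \<sigma> * x)) * bohr_coeff g x)"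
      by (rule has_mean_line; fact)+
    show "continuous_on UNIV (\<lambda>t. f (Complex \<sigma> t) * cis (x * t))" "continuous_on UNIV (\<lambda>t. g (Complex \<sigma> t) * cis (x * t))"
      by (intro almost_periodic_continuous almost_periodic_mult almost_periodic_cis almost_periodic_holomorphic_line assms)+
    show "norm (f (Complex \<sigma> t) * cis (x * t) - g (Complex \<sigma> t) * cis (x * t)) \<le> \<delta>" for t
      using assms(3)[of "Complex \<sigma> t"] by (simp add: norm_mult flip: left_diff_distrib)
  qed
  then have "exp (- \<sigma> * x) * norm (bohr_coeff f x - bohr_coeff g x) \<le> \<delta>"
    unfolding right_diff_distrib[symmetric] norm_mult norm_of_real by simp
  then have "exp (\<sigma> * x) * (exp (- \<sigma> * x) * norm (bohr_coeff f x - bohr_coeff g x)) \<le> exp (\<sigma> * x) * \<delta>"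
    by (intro mult_left_mono) auto
  moreover have "exp (\<sigma> * x) * (exp (- \<sigma> * x) * y) = y" for y
    by (simp flip: mult.assoc exp_add)
  ultimately show ?thesis by (simp only:)
qed

lemma bohr_coeff_bound:
  assumes f: "almost_periodic_holomorphic f" and C: "\<And>s. Re s > 0 \<Longrightarrow> norm (f s) \<le> C"
  shows "norm (bohr_coeff f x) \<le> exp x * C"
proof -
  have "almost_periodic_holomorphic (\<lambda>s. 0)"
    by (auto simp: almost_periodic_holomorphic_def uniformly_almost_periodic_halfplane_def uniformly_almost_periodic_iff almost_periodic_const image_constant_conv)
  moreover have "bohr_coeff (\<lambda>s. 0) x = 0" by (rule bohr_coeff_eqI) (simp add: bohr_mean_def[abs_def])
  ultimately show ?thesis using bohr_coeff_diff_le[OF f, of "\<lambda>s. 0" 1 C x] C by simp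
qed

lemma H_infty_translate:
  assumes f: "f \<in> H_infty lam" and "\<sigma> > 0"
  shows "(\<lambda>s. f (of_real \<sigma> + s)) \<in> H_infty lam"
proof -
  have hf: "almost_periodic_holomorphic f" using f by (simp add: H_infty_iff)
  let ?g = "\<lambda>s. f (of_real \<sigma> + s)"
  have line: "?g (Complex \<rho> t) = f (Complex (\<sigma> + \<rho>) t)" for \<rho> t
    by (rule arg_cong[of _ _ f]) (simp add: complex_eq_iff)
  have img: "(+) (of_real \<sigma>) ` right_halfplane \<subseteq> right_halfplane"
    using \<open>\<sigma> > 0\<close> by (auto simp: right_halfplane_def)
  have "almost_periodic_holomorphic ?g"
    unfolding almost_periodic_holomorphic_def
  proof (intro conjI)
    have "?g ` right_halfplane \<subseteq> f ` right_halfplane" using img by auto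
    then show "bounded (?g ` right_halfplane)" using hf bounded_subset by (auto simp: almost_periodic_holomorphic_def)
    have "(f \<circ> (+) (of_real \<sigma>)) holomorphic_on right_halfplane"
      using hf img by (intro holomorphic_on_compose_gen[where t = right_halfplane] holomorphic_intros) (auto simp: almost_periodic_holomorphic_def)
    then show "?g holomorphic_on right_halfplane" by (simp add: o_def)
    show "uniformly_almost_periodic_halfplane ?g"
      unfolding uniformly_almost_periodic_halfplane_def uniformly_almost_periodic_iff line
      using almost_periodic_holomorphic_line[OF hf] \<open>\<sigma> > 0\<close> by simp
  qed
  moreover have "bohr_coeff ?g x = 0" if "x \<notin> range lam" for x
  proof (rule bohr_coeff_eqI)
    fix \<rho> :: real assume "\<rho> > 0"
    have eq: "bohr_mean ?g x \<rho> T = of_real (exp (- \<sigma> * x)) * bohr_mean f x (\<sigma> + \<rho>) T" for T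
      unfolding bohr_mean_line line by (simp add: distrib_right exp_add exp_minus field_simps)
    have "bohr_coeff f x = 0" using f that by (simp add: H_infty_iff)
    then have "(bohr_mean f x (\<sigma> + \<rho>) \<longlongrightarrow> 0) at_top"
      using bohr_coeff_lim[OF hf, of "\<sigma> + \<rho>" x] \<open>\<rho> > 0\<close> \<open>\<sigma> > 0\<close> by simp
    then show "(bohr_mean ?g x \<rho> \<longlongrightarrow> 0) at_top"
      unfolding eq by (rule tendsto_mult_right_zero)
  qed
  ultimately show ?thesis by (simp add: H_infty_iff)
qed

text \<open>Convolution along the vertical line through \<open>s\<close> with the Fejer kernel compressed to scale \<open>1 / X\<close>.
  On a Dirichlet series it is the Riesz mean of first order.\<close>

definition vertical_mean :: "real \<Rightarrow> (complex \<Rightarrow> complex) \<Rightarrow> complex \<Rightarrow> complex" where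
  "vertical_mean X f s = (LBINT w. of_real (fejer w) * f (Complex (Re s) (Im s + 1 / X * w)))"

definition fejer_weight :: "real \<Rightarrow> complex" where
  "fejer_weight b = (LBINT w. of_real (fejer w) * cis (- b * w))"

lemma norm_fejer_weight_le: "norm (fejer_weight b) \<le> 1"
proof -
  have "norm (fejer_weight b) \<le> (LBINT w. fejer w)"
    unfolding fejer_weight_def
  proof (rule Bochner_Integration.integral_norm_bound_integral[OF _ integrable_fejer])
    have "(\<lambda>w. cis (- b * w)) \<in> borel_measurable borel"
      by (intro borel_measurable_continuous_onI continuous_intros)
    then show "integrable lborel (\<lambda>w. of_real (fejer w) * cis (- b * w))"
      using integrable_fejer by (intro integrable_kernel_mult[where C = 1]) auto
  qed (simp add: norm_mult fejer_nonneg)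
  then show ?thesis by (simp add: integral_fejer)
qed

lemma finite_frequencies_below:
  assumes "frequency lam" shows "finite {n. lam n < X}"
proof -
  have "\<not> (\<forall>x\<in>range lam. x \<le> X)" using assms unfolding frequency_def bdd_above_def by blast
  then obtain N where N: "lam N > X" by (auto simp: not_le)
  have "strict_mono lam" using assms by (simp only: frequency_def)
  have "n < N" if "lam n < X" for n
  proof -
    have "lam n < lam N" using N that by linarith
    then show ?thesis by (simp only: strict_mono_less[OF \<open>strict_mono lam\<close>])
  qed
  then have "{n. lam n < X} \<subseteq> {..<N}" by blast
  then show ?thesis by (rule finite_subset) simp
qed

text \<open>Both sides are almost periodic along each vertical line. Their Fourier coefficients agree: at
  \<open>lam n < X\<close> by construction, at \<open>lam n \<ge> X\<close> because the Fourier transform of the kernel vanishes there,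
  and elsewhere because \<open>f\<close> has no other frequencies. The uniqueness theorem makes them equal. Hence
  the mean is determined by finitely many Bohr coefficients of \<open>f\<close>.\<close>

lemma vertical_mean_eq_dirichlet_polynomial:
  assumes lam: "frequency lam" and f: "f \<in> H_infty lam" and X: "X > 0" and s: "Re s > 0"
  shows "vertical_mean X f s =
    (\<Sum>n | lam n < X. bohr_coeff f (lam n) * fejer_weight (lam n / X) * exp (- of_real (lam n) * s))"
proof -
  have hf: "almost_periodic_holomorphic f" using f by (simp add: H_infty_iff)
  define \<sigma> where "\<sigma> = Re s"
  have "\<sigma> > 0" using s by (simp add: \<sigma>_def)
  define S where "S = {n. lam n < X}"
  have "finite S" unfolding S_def by (rule finite_frequencies_below[OF lam])
  define u where "u = (\<lambda>t. f (Complex \<sigma> t))"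
  have u: "almost_periodic u" unfolding u_def by (rule almost_periodic_holomorphic_line[OF hf \<open>\<sigma> > 0\<close>])
  define a where "a = (\<lambda>x. of_real (exp (- \<sigma> * x)) * bohr_coeff f x)"
  define p where "p = (\<lambda>t. LBINT w. of_real (fejer w) * u (t + 1 / X * w))"
  define q where "q = (\<lambda>t. \<Sum>n\<in>S. a (lam n) * fejer_weight (lam n / X) * cis (- lam n * t))"
  have p: "almost_periodic p" unfolding p_def by (rule almost_periodic_convolution[OF integrable_fejer u])
  have q: "almost_periodic q" unfolding q_def by (intro almost_periodic_sum almost_periodic_mult almost_periodic_const almost_periodic_cis)
  have "has_mean (\<lambda>t. (p t - q t) * cis (x * t)) 0" for x
  proof -
    have "has_mean (\<lambda>t. u t * cis (x * t)) (a x)"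
      unfolding u_def a_def by (rule has_mean_line[OF hf \<open>\<sigma> > 0\<close>])
    from has_mean_convolution[OF integrable_fejer u this, of "1 / X"]
    have 1: "has_mean (\<lambda>t. p t * cis (x * t)) (a x * fejer_weight (x / X))"
      by (simp add: p_def fejer_weight_def)
    have "has_mean (\<lambda>t. \<Sum>n\<in>S. a (lam n) * fejer_weight (lam n / X) * cis ((x - lam n) * t))
        (\<Sum>n\<in>S. a (lam n) * fejer_weight (lam n / X) * (if x - lam n = 0 then 1 else 0))"
      by (intro has_mean_sum has_mean_cmult has_mean_cis continuous_intros)
    moreover have "(\<Sum>n\<in>S. a (lam n) * fejer_weight (lam n / X) * cis ((x - lam n) * t)) = q t * cis (x * t)" for t
      unfolding q_def sum_distrib_right by (intro sum.cong refl) (simp add: cis_mult algebra_simps)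
    moreover have "(\<Sum>n\<in>S. a (lam n) * fejer_weight (lam n / X) * (if x - lam n = 0 then 1 else 0))
        = a x * fejer_weight (x / X)"
    proof (cases "x \<in> lam ` S")
      case True
      then obtain m where m: "m \<in> S" "x = lam m" by blast
      have "strict_mono lam" using lam by (simp only: frequency_def)
      then have inj: "lam m = lam n \<longleftrightarrow> n = m" for n
        using strict_mono_eq[of lam m n] by blast
      have "(\<Sum>n\<in>S. a (lam n) * fejer_weight (lam n / X) * (if x - lam n = 0 then 1 else 0))
          = (\<Sum>n\<in>S. if n = m then a (lam n) * fejer_weight (lam n / X) else 0)"
        by (intro sum.cong) (auto simp: m inj)
      then show ?thesis using m \<open>finite S\<close> by simp
    next
      case False
      have "a x * fejer_weight (x / X) = 0"
      proof (cases "x \<in> range lam")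
        case True
        then obtain n where "x = lam n" by blast
        then have "x \<ge> X" using False by (auto simp: S_def)
        then have "fejer_weight (x / X) = 0"
          unfolding fejer_weight_def using X by (intro fejer_fourier_zero) simp
        then show ?thesis by simp
      next
        case False
        then show ?thesis using f by (simp add: a_def H_infty_iff)
      qed
      moreover have "(\<Sum>n\<in>S. a (lam n) * fejer_weight (lam n / X) * (if x - lam n = 0 then 1 else 0)) = 0"
        using False by (intro sum.neutral) auto
      ultimately show ?thesis by simp
    qed
    ultimately have 2: "has_mean (\<lambda>t. q t * cis (x * t)) (a x * fejer_weight (x / X))" by simp
    have "has_mean (\<lambda>t. p t * cis (x * t) - q t * cis (x * t)) (a x * fejer_weight (x / X) - a x * fejer_weight (x / X))"
      by (intro has_mean_diff 1 2 continuous_intros almost_periodic_continuous p q)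
    then show ?thesis by (simp add: left_diff_distrib)
  qed
  then have "p (Im s) - q (Im s) = 0"
    by (intro almost_periodic_eq_0_if_means_0[where v = "\<lambda>t. p t - q t"] almost_periodic_diff p q)
  moreover have "vertical_mean X f s = p (Im s)"
    by (simp add: vertical_mean_def p_def u_def \<sigma>_def)
  moreover have "q (Im s) = (\<Sum>n\<in>S. bohr_coeff f (lam n) * fejer_weight (lam n / X) * exp (- of_real (lam n) * s))"
    unfolding q_def by (intro sum.cong refl) (simp add: a_def \<sigma>_def exp_eq_polar mult.commute[of "lam _"])
  ultimately show ?thesis by (simp add: S_def)
qed

text \<open>Cauchy's inequality on discs of radius \<open>\<sigma> / 2\<close> bounds the derivative.\<close>

lemma vertical_Lipschitz:
  assumes f: "f holomorphic_on right_halfplane" and C: "\<And>s. Re s > 0 \<Longrightarrow> norm (f s) \<le> C"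
    and \<sigma>: "\<sigma> > 0" "\<sigma> \<le> \<rho>"
  shows "norm (f (Complex \<rho> a) - f (Complex \<rho> b)) \<le> 2 * C / \<sigma> * \<bar>a - b\<bar>"
proof -
  have "norm (f (Complex \<rho> a) - f (Complex \<rho> b)) \<le> 2 * C / \<sigma> * norm (Complex \<rho> a - Complex \<rho> b)"
  proof (rule field_differentiable_bound)
    show "convex {s. Re s \<ge> \<sigma>}" by (rule convex_halfspace_Re_ge)
    fix z assume "z \<in> {s. Re s \<ge> \<sigma>}"
    then have z: "Re z \<ge> \<sigma>" by simp
    then have "z \<in> right_halfplane" using \<sigma> by (simp add: right_halfplane_def)
    then show "(f has_field_derivative deriv f z) (at z within {s. Re s \<ge> \<sigma>})"
      using holomorphic_derivI[OF f open_right_halfplane] has_field_derivative_at_within by blast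
    have sub: "cball z (\<sigma> / 2) \<subseteq> right_halfplane"
    proof
      fix w assume "w \<in> cball z (\<sigma> / 2)"
      then have "\<bar>Re (z - w)\<bar> \<le> \<sigma> / 2" using abs_Re_le_cmod[of "z - w"] by (simp add: dist_norm)
      then have "Re z - Re w \<le> \<sigma> / 2" by (simp only: abs_le_iff minus_complex.sel)
      then show "w \<in> right_halfplane" using z \<sigma> by (simp add: right_halfplane_def)
    qed
    have "norm ((deriv ^^ 1) f z) \<le> fact 1 * C / (\<sigma> / 2) ^ 1"
    proof (rule Cauchy_inequality)
      show "f holomorphic_on ball z (\<sigma> / 2)"
        using holomorphic_on_subset[OF f] sub ball_subset_cball by blast
      show "continuous_on (cball z (\<sigma> / 2)) f"
        using holomorphic_on_imp_continuous_on[OF holomorphic_on_subset[OF f sub]] .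
      fix w assume "norm (z - w) = \<sigma> / 2"
      then have "w \<in> right_halfplane" using sub by (auto simp: dist_norm)
      then show "norm (f w) \<le> C" by (intro C) (simp add: right_halfplane_def)
    qed (use \<sigma> in auto)
    then show "norm (deriv f z) \<le> 2 * C / \<sigma>" by (simp add: mult.commute)
  qed (use \<sigma> in auto)
  then show ?thesis by (simp add: complex_diff cmod_def)
qed

lemma norm_fejer_min_le:
  assumes "0 \<le> a" "0 \<le> b" shows "norm (fejer w * min a b) \<le> fejer w * a"
proof -
  have "fejer w * \<bar>min a b\<bar> \<le> fejer w * a" using assms fejer_nonneg by (intro mult_left_mono) auto
  then show ?thesis by (simp add: abs_mult fejer_nonneg)
qed

text \<open>The approximation error of the vertical mean at scale \<open>1 / X\<close> for a function that is bounded by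
  \<open>C\<close> and \<open>L\<close>-Lipschitz along vertical lines. It depends on the function only through \<open>C\<close> and \<open>L\<close>, so one
  \<open>X\<close> serves a whole bounded family.\<close>

definition fejer_error :: "real \<Rightarrow> real \<Rightarrow> real \<Rightarrow> real" where
  "fejer_error C L X = (LBINT w. fejer w * min (2 * C) (L * \<bar>1 / X * w\<bar>))"

lemma fejer_error_tendsto: 
  assumes "C \<ge> 0" "L \<ge> 0" shows "(fejer_error C L \<longlongrightarrow> 0) at_top"
proof -
  have "((\<lambda>X. LBINT w. fejer w * min (2 * C) (L * \<bar>1 / X * w\<bar>)) \<longlongrightarrow> (LBINT w::real. 0)) at_top"
  proof (rule integral_dominated_convergence_at_top[where w = "\<lambda>w. fejer w * (2 * C)"])
    show "integrable lborel (\<lambda>w. fejer w * (2 * C))" using integrable_fejer by simp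
    show "\<forall>\<^sub>F X in at_top. AE w in lborel. norm (fejer w * min (2 * C) (L * \<bar>1 / X * w\<bar>)) \<le> fejer w * (2 * C)"
      using assms by (intro always_eventually allI AE_I2 norm_fejer_min_le) auto
    show "AE w in lborel. ((\<lambda>X. fejer w * min (2 * C) (L * \<bar>1 / X * w\<bar>)) \<longlongrightarrow> 0) at_top"
    proof (intro AE_I2)
      fix w :: real
      have inv: "((\<lambda>X::real. 1 / X) \<longlongrightarrow> 0) at_top"
        by (intro tendsto_divide_0[OF tendsto_const] filterlim_at_top_imp_at_infinity filterlim_ident)
      have "((\<lambda>X. fejer w * min (2 * C) (L * \<bar>1 / X * w\<bar>)) \<longlongrightarrow> fejer w * min (2 * C) (L * \<bar>0 * w\<bar>)) at_top"
        by (intro tendsto_intros inv)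
      then show "((\<lambda>X. fejer w * min (2 * C) (L * \<bar>1 / X * w\<bar>)) \<longlongrightarrow> 0) at_top"
        using assms by (simp only: mult_zero_left abs_zero mult_zero_right min_absorb2 zero_le_mult_iff) simp
    qed
  qed simp_all
  then show ?thesis by (simp add: fejer_error_def[abs_def])
qed

lemma vertical_mean_error:
  assumes f: "almost_periodic_holomorphic f" and C: "\<And>s. Re s > 0 \<Longrightarrow> norm (f s) \<le> C" and \<sigma>: "\<sigma> > 0" "\<sigma> \<le> Re s"
  shows "norm (f s - vertical_mean X f s) \<le> fejer_error C (2 * C / \<sigma>) X"
proof -
  have C0: "C \<ge> 0" using C[of 1] by (intro order_trans[OF norm_ge_zero]) simp
  let ?u = "\<lambda>t. f (Complex (Re s) t)"
  have u: "almost_periodic ?u" using \<sigma> by (intro almost_periodic_holomorphic_line f) auto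
  have int: "integrable lborel (\<lambda>w. of_real (fejer w) * ?u (Im s + 1 / X * w))"
    by (rule integrable_kernel_almost_periodic[OF integrable_fejer u])
  have "f s = (LBINT w. of_real (fejer w) * f s)"
    using integral_complex_of_real[of lborel fejer] by (simp add: integral_fejer)
  moreover have int0: "integrable lborel (\<lambda>w. of_real (fejer w) * f s)"
    by (intro integrable_mult_left integrable_of_real integrable_fejer)
  ultimately have "f s - vertical_mean X f s = (LBINT w. of_real (fejer w) * f s - of_real (fejer w) * ?u (Im s + 1 / X * w))"
    unfolding vertical_mean_def Bochner_Integration.integral_diff[OF int0 int] by (simp only:)
  also have "norm \<dots> \<le> fejer_error C (2 * C / \<sigma>) X"
    unfolding fejer_error_def
  proof (rule Bochner_Integration.integral_norm_bound_integral)
    show "integrable lborel (\<lambda>w. of_real (fejer w) * f s - of_real (fejer w) * ?u (Im s + 1 / X * w))"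
      by (rule Bochner_Integration.integrable_diff[OF int0 int])
    show "integrable lborel (\<lambda>w. fejer w * min (2 * C) (2 * C / \<sigma> * \<bar>1 / X * w\<bar>))"
    proof (rule Bochner_Integration.integrable_bound)
      show "integrable lborel (\<lambda>w. fejer w * (2 * C))" using integrable_fejer by simp
      show "AE w in lborel. norm (fejer w * min (2 * C) (2 * C / \<sigma> * \<bar>1 / X * w\<bar>)) \<le> norm (fejer w * (2 * C))"
        using C0 \<sigma> by (intro AE_I2 order_trans[OF norm_fejer_min_le]) (auto simp: fejer_nonneg)
    qed simp
    fix w
    have "norm (f s - ?u (Im s + 1 / X * w)) \<le> 2 * C"
      using C[of s] C[of "Complex (Re s) (Im s + 1 / X * w)"] \<sigma>
      by (intro order_trans[OF norm_triangle_ineq4]) auto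
    moreover have "norm (f s - ?u (Im s + 1 / X * w)) \<le> 2 * C / \<sigma> * \<bar>1 / X * w\<bar>"
      using vertical_Lipschitz[of f C \<sigma> "Re s" "Im s" "Im s + 1 / X * w"] f C \<sigma>
      by (simp add: almost_periodic_holomorphic_def)
    ultimately show "norm (of_real (fejer w) * f s - of_real (fejer w) * ?u (Im s + 1 / X * w))
        \<le> fejer w * min (2 * C) (2 * C / \<sigma> * \<bar>1 / X * w\<bar>)"
      unfolding right_diff_distrib[symmetric] norm_mult using fejer_nonneg[of w]
      by (intro mult_mono) auto
  qed
  finally show ?thesis .
qed

section \<open>Compactness\<close>

lemma H_infty_normD:
  assumes "f \<in> H_infty lam" "H_infty_norm f \<le> C" "Re s > 0"
  shows "norm (f s) \<le> C"
proof -
  obtain B where B: "\<And>s. Re s > 0 \<Longrightarrow> norm (f s) \<le> B"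
    using assms(1) almost_periodic_holomorphic_bound unfolding H_infty_iff by blast
  have "norm (f s) \<le> H_infty_norm f"
    unfolding H_infty_norm_def
    using assms(3) B by (intro cSUP_upper bdd_aboveI2[where M = B]) (auto simp: right_halfplane_def)
  then show ?thesis using assms(2) by linarith
qed

text \<open>The exponentials with nonnegative frequencies and the Fejer weights are at most \<open>1\<close> in modulus, so
  close coefficients give polynomials that are close on the whole closed half-plane.\<close>

lemma dirichlet_polynomial_diff_le:
  assumes "frequency lam" "X > 0" "Re s \<ge> 0"
  shows "norm ((\<Sum>n | lam n < X. a n * fejer_weight (lam n / X) * exp (- of_real (lam n) * s))
      - (\<Sum>n | lam n < X. b n * fejer_weight (lam n / X) * exp (- of_real (lam n) * s)))
    \<le> (\<Sum>n | lam n < X. norm (a n - b n))"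
  unfolding sum_subtractf[symmetric]
proof (rule sum_norm_le)
  fix n
  have "norm (exp (- of_real (lam n) * s)) \<le> 1"
    using assms by (simp add: frequency_def)
  moreover have "norm (fejer_weight (lam n / X)) \<le> 1" by (rule norm_fejer_weight_le)
  ultimately have "norm (a n - b n) * (norm (fejer_weight (lam n / X)) * norm (exp (- of_real (lam n) * s)))
      \<le> norm (a n - b n) * (1 * 1)"
    by (intro mult_left_mono mult_mono) auto
  then show "norm (a n * fejer_weight (lam n / X) * exp (- of_real (lam n) * s)
      - b n * fejer_weight (lam n / X) * exp (- of_real (lam n) * s)) \<le> norm (a n - b n)"
    by (simp add: norm_mult mult.assoc flip: left_diff_distrib)
qed

text \<open>Choose \<open>X\<close> so large that every member of the family is within \<open>e / 3\<close> of its
  vertical mean on the whole of \<open>Re s \<ge> \<sigma>\<close>. The vertical means involve only the finitely many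
  coefficients with \<open>lam n < X\<close>, and these converge.\<close>

lemma uniformly_Cauchy_if_coefficients_converge:
  assumes lam: "frequency lam" and F: "\<And>k. F k \<in> H_infty lam"
    and C: "\<And>k s. Re s > 0 \<Longrightarrow> norm (F k s) \<le> C"
    and conv: "\<And>n. convergent (\<lambda>k. bohr_coeff (F k) (lam n))" and \<sigma>: "\<sigma> > 0"
  shows "uniformly_Cauchy_on {s. Re s \<ge> \<sigma>} F"
proof (rule uniformly_Cauchy_onI)
  fix e :: real assume "e > 0"
  have hF: "almost_periodic_holomorphic (F k)" for k using F by (simp add: H_infty_iff)
  have "C \<ge> 0" using C[of 1 0] by (intro order_trans[OF norm_ge_zero]) simp
  then have "(fejer_error C (2 * C / \<sigma>) \<longlongrightarrow> 0) at_top" using \<sigma> by (intro fejer_error_tendsto) auto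
  then have "\<forall>\<^sub>F X in at_top. fejer_error C (2 * C / \<sigma>) X < e / 3 \<and> X > 0"
    using \<open>e > 0\<close> by (intro eventually_conj order_tendstoD(2) eventually_gt_at_top) auto
  then obtain X where X: "fejer_error C (2 * C / \<sigma>) X < e / 3" "X > 0"
    unfolding eventually_at_top_linorder by blast
  define S where "S = {n. lam n < X}"
  have "finite S" unfolding S_def by (rule finite_frequencies_below[OF lam])
  have "\<exists>M. \<forall>m\<ge>M. \<forall>k\<ge>M. norm (bohr_coeff (F m) (lam n) - bohr_coeff (F k) (lam n)) < e / (3 * (real (card S) + 1))" for n
  proof (rule CauchyD)
    show "Cauchy (\<lambda>k. bohr_coeff (F k) (lam n))" using conv by (rule convergent_Cauchy)
  qed (use \<open>e > 0\<close> in \<open>simp add: add_nonneg_pos\<close>)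
  then obtain M where M: "\<And>n m k. m \<ge> M n \<Longrightarrow> k \<ge> M n \<Longrightarrow>
      norm (bohr_coeff (F m) (lam n) - bohr_coeff (F k) (lam n)) < e / (3 * (real (card S) + 1))"
    by metis
  define K where "K = Max (insert 0 (M ` S))"
  have K: "M n \<le> K" if "n \<in> S" for n unfolding K_def using \<open>finite S\<close> that by (intro Max_ge) auto
  show "\<exists>M. \<forall>s\<in>{s. Re s \<ge> \<sigma>}. \<forall>m\<ge>M. \<forall>k\<ge>M. dist (F m s) (F k s) < e"
  proof (intro exI[of _ K] ballI allI impI)
    fix s m k assume s: "s \<in> {s. Re s \<ge> \<sigma>}" and mk: "m \<ge> K" "k \<ge> K"
    have s': "\<sigma> \<le> Re s" "Re s > 0" using s \<sigma> by auto
    have err: "norm (F j s - vertical_mean X (F j) s) < e / 3" for j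
      by (rule le_less_trans[OF vertical_mean_error[OF hF C \<sigma> s'(1)] X(1)])
    have "norm (vertical_mean X (F m) s - vertical_mean X (F k) s)
        \<le> (\<Sum>n\<in>S. norm (bohr_coeff (F m) (lam n) - bohr_coeff (F k) (lam n)))"
      unfolding vertical_mean_eq_dirichlet_polynomial[OF lam F X(2) s'(2)] S_def
      using lam X(2) s'(2) by (intro dirichlet_polynomial_diff_le) auto
    also have "\<dots> \<le> (\<Sum>n\<in>S. e / (3 * (real (card S) + 1)))"
    proof (rule sum_mono)
      fix n assume "n \<in> S"
      then have "M n \<le> m" "M n \<le> k" using K mk le_trans by blast+
      then show "norm (bohr_coeff (F m) (lam n) - bohr_coeff (F k) (lam n)) \<le> e / (3 * (real (card S) + 1))"
        by (rule less_imp_le[OF M])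
    qed
    also have "\<dots> \<le> e / 3" using \<open>e > 0\<close> by (simp add: field_simps)
    finally have mid: "dist (vertical_mean X (F m) s) (vertical_mean X (F k) s) \<le> e / 3" by (simp add: dist_norm)
    show "dist (F m s) (F k s) < e"
      using mid err[of m] err[of k] dist_triangle[of "F m s" "F k s" "vertical_mean X (F m) s"]
        dist_triangle[of "vertical_mean X (F m) s" "F k s" "vertical_mean X (F k) s"]
        dist_commute[of "F k s" "vertical_mean X (F k) s"]
      unfolding dist_norm[of "F m s" "vertical_mean X (F m) s"] dist_norm[of "F k s" "vertical_mean X (F k) s"]
      by linarith
  qed
qed

text \<open>Boundedness, holomorphy and almost periodicity survive uniform limits on smaller half-planes. So
  do vanishing Bohr coefficients, because on a fixed line they depend continuously on the function.\<close>

lemma H_infty_uniform_limit: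
  assumes F: "\<And>k. F k \<in> H_infty lam" and C: "\<And>k s. Re s > 0 \<Longrightarrow> norm (F k s) \<le> C"
    and lim: "\<And>\<sigma>. \<sigma> > 0 \<Longrightarrow> uniform_limit {s. Re s \<ge> \<sigma>} F f sequentially"
  shows "f \<in> H_infty lam"
proof -
  have hF: "almost_periodic_holomorphic (F k)" for k using F by (simp add: H_infty_iff)
  have pointwise: "(\<lambda>k. F k s) \<longlonglongrightarrow> f s" if "Re s > 0" for s
    using tendsto_uniform_limitI[OF lim[OF that], of s] by simp
  have "almost_periodic_holomorphic f"
    unfolding almost_periodic_holomorphic_def
  proof (intro conjI)
    have "norm (f s) \<le> C" if "Re s > 0" for s
      using C[OF that] by (intro tendsto_upperbound[OF tendsto_norm[OF pointwise[OF that]]]) auto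
    then show "bounded (f ` right_halfplane)"
      by (intro boundedI[of _ C]) (auto simp: right_halfplane_def)
    show "f holomorphic_on right_halfplane"
    proof (rule holomorphic_uniform_sequence[OF open_right_halfplane])
      show "F k holomorphic_on right_halfplane" for k using hF by (simp add: almost_periodic_holomorphic_def)
      fix s assume "s \<in> right_halfplane"
      then have s: "Re s > 0" by (simp add: right_halfplane_def)
      have sub: "cball s (Re s / 2) \<subseteq> {z. Re z \<ge> Re s / 2}"
      proof
        fix w assume "w \<in> cball s (Re s / 2)"
        then have "\<bar>Re (s - w)\<bar> \<le> Re s / 2" using abs_Re_le_cmod[of "s - w"] by (simp add: dist_norm)
        then have "Re s - Re w \<le> Re s / 2" by (simp only: abs_le_iff minus_complex.sel)
        then show "w \<in> {z. Re z \<ge> Re s / 2}" by simp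
      qed
      show "\<exists>d>0. cball s d \<subseteq> right_halfplane \<and> uniform_limit (cball s d) F f sequentially"
        using s sub uniform_limit_on_subset[OF lim sub]
        by (intro exI[of _ "Re s / 2"]) (force simp: right_halfplane_def)
    qed
    show "uniformly_almost_periodic_halfplane f"
      unfolding uniformly_almost_periodic_halfplane_def uniformly_almost_periodic_iff
    proof (intro allI impI)
      fix \<sigma> :: real assume "\<sigma> > 0"
      show "almost_periodic (\<lambda>t. f (Complex \<sigma> t))"
      proof (rule almost_periodic_uniform_limit)
        show "almost_periodic (\<lambda>t. F k (Complex \<sigma> t))" for k by (rule almost_periodic_holomorphic_line[OF hF \<open>\<sigma> > 0\<close>])
        show "uniform_limit UNIV (\<lambda>k t. F k (Complex \<sigma> t)) (\<lambda>t. f (Complex \<sigma> t)) sequentially"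
          by (rule uniform_limit_compose'[OF lim[OF \<open>\<sigma> > 0\<close>]]) simp
      qed
    qed
  qed
  moreover have "bohr_coeff f x = 0" if "x \<notin> range lam" for x
  proof -
    have "norm (bohr_coeff f x) \<le> 0"
    proof (rule field_le_epsilon)
      fix e :: real assume "e > 0"
      then obtain k where k: "\<And>s. Re s \<ge> 1 \<Longrightarrow> dist (F k s) (f s) < exp (- x) * e"
        using uniform_limitD[OF lim[of 1], of "exp (- x) * e"] by (auto simp: eventually_sequentially)
      have "norm (bohr_coeff f x - bohr_coeff (F k) x) \<le> exp (1 * x) * (exp (- x) * e)"
        using k by (intro bohr_coeff_diff_le \<open>almost_periodic_holomorphic f\<close> hF) (auto simp: dist_norm norm_minus_commute intro!: less_imp_le)
      moreover have "bohr_coeff (F k) x = 0" using F that by (simp add: H_infty_iff)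
      moreover have "exp (1 * x) * (exp (- x) * e) = e" by (simp flip: mult.assoc exp_add)
      ultimately show "norm (bohr_coeff f x) \<le> 0 + e" by (simp only: diff_zero add_0)
    qed
    then show ?thesis by simp
  qed
  ultimately show ?thesis by (simp add: H_infty_iff)
qed

lemma H_infty_norm_tendsto_0:
  assumes "uniform_limit {s. Re s \<ge> \<sigma>} F f sequentially"
  shows "(\<lambda>k. H_infty_norm (\<lambda>s. F k (of_real \<sigma> + s) - f (of_real \<sigma> + s))) \<longlonglongrightarrow> 0"
proof (rule LIMSEQ_I)
  fix e :: real assume "e > 0"
  then obtain K where K: "\<And>k s. k \<ge> K \<Longrightarrow> Re s \<ge> \<sigma> \<Longrightarrow> dist (F k s) (f s) < e / 2"
    using uniform_limitD[OF assms, of "e / 2"] by (auto simp: eventually_sequentially)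
  have "norm (H_infty_norm (\<lambda>s. F k (of_real \<sigma> + s) - f (of_real \<sigma> + s)) - 0) < e" if "k \<ge> K" for k
  proof -
    let ?g = "\<lambda>s. norm (F k (of_real \<sigma> + s) - f (of_real \<sigma> + s))"
    have le: "?g s \<le> e / 2" if "s \<in> right_halfplane" for s
      using K[OF \<open>k \<ge> K\<close>, of "of_real \<sigma> + s"] that by (simp add: dist_norm right_halfplane_def)
    have "1 \<in> right_halfplane" by (simp add: right_halfplane_def)
    then have "(SUP s\<in>right_halfplane. ?g s) \<le> e / 2" using le by (intro cSUP_least) auto
    moreover have "0 \<le> (SUP s\<in>right_halfplane. ?g s)"
      using \<open>1 \<in> right_halfplane\<close> le by (intro cSUP_upper2[of _ _ 1] bdd_aboveI2[where M = "e / 2"]) auto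
    ultimately show ?thesis using \<open>e > 0\<close> by (simp add: H_infty_norm_def)
  qed
  then show "\<exists>K. \<forall>k\<ge>K. norm (H_infty_norm (\<lambda>s. F k (of_real \<sigma> + s) - f (of_real \<sigma> + s)) - 0) < e" by blast
qed

theorem theorem3p4:
  fixes lam :: "nat \<Rightarrow> real" and F :: "nat \<Rightarrow> complex \<Rightarrow> complex"
  assumes "frequency lam"
    and "\<forall>N. F N \<in> H_infty lam"
    and "\<exists>C. \<forall>N. H_infty_norm (F N) \<le> C"
  shows "\<exists>(r :: nat \<Rightarrow> nat) f. strict_mono r \<and> f \<in> H_infty lam \<and>
           (\<forall>\<sigma>>0. converges_in_H_infty lam
              (\<lambda>k s. F (r k) (of_real \<sigma> + s)) (\<lambda>s. f (of_real \<sigma> + s)))"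
proof -
  have F: "F N \<in> H_infty lam" for N using assms(2) by blast
  obtain C where "\<And>N. H_infty_norm (F N) \<le> C" using assms(3) by blast
  then have C: "norm (F N s) \<le> C" if "Re s > 0" for N s using that F by (intro H_infty_normD) auto
  have hF: "almost_periodic_holomorphic (F N)" for N using F by (simp add: H_infty_iff)
  \<comment> \<open>the coefficients are normalised so that one bound serves all of them\<close>
  define c where "c = (\<lambda>N n. of_real (exp (- lam n)) * bohr_coeff (F N) (lam n))"
  have c: "norm (c N n) \<le> C" for N n
  proof -
    have "norm (c N n) \<le> exp (- lam n) * (exp (lam n) * C)"
      unfolding c_def norm_mult norm_of_real using bohr_coeff_bound[OF hF C, where x = "lam n"]
      by (intro mult_mono) auto
    also have "\<dots> = C" by (simp flip: mult.assoc exp_add)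
    finally show ?thesis .
  qed
  obtain r where r: "strict_mono (r :: nat \<Rightarrow> nat)" "\<And>n. \<exists>l. (\<lambda>k. c (r k) n) \<longlonglongrightarrow> l"
  proof (rule function_convergent_subsequence[of UNIV c C])
    fix r :: "nat \<Rightarrow> nat"
    assume "strict_mono r" "\<And>n. n \<in> UNIV \<Longrightarrow> \<exists>l. (\<lambda>k. c (r k) n) \<longlonglongrightarrow> l"
    then show thesis by (intro that) auto
  qed (use c in auto)
  have conv: "convergent (\<lambda>k. bohr_coeff (F (r k)) (lam n))" for n
  proof -
    obtain l where "(\<lambda>k. c (r k) n) \<longlonglongrightarrow> l" using r(2) by blast
    then have "(\<lambda>k. of_real (exp (lam n)) * c (r k) n) \<longlonglongrightarrow> of_real (exp (lam n)) * l" by (rule tendsto_mult_left)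
    moreover have "of_real (exp (lam n)) * c N n = bohr_coeff (F N) (lam n)" for N
      using exp_mult_cancel[of 1 "lam n"] by (simp add: c_def)
    ultimately show ?thesis by (auto simp: convergent_def)
  qed
  have Cauchy: "uniformly_Cauchy_on {s. Re s \<ge> \<sigma>} (\<lambda>k. F (r k))" if "\<sigma> > 0" for \<sigma>
    using F C conv that by (intro uniformly_Cauchy_if_coefficients_converge[OF assms(1)]) auto
  define f where "f = (\<lambda>s. lim (\<lambda>k. F (r k) s))"
  have lim: "uniform_limit {s. Re s \<ge> \<sigma>} (\<lambda>k. F (r k)) f sequentially" if \<sigma>: "\<sigma> > 0" for \<sigma>
    using Cauchy_uniformly_convergent[OF Cauchy[OF \<sigma>]]
    unfolding f_def uniformly_convergent_uniform_limit_iff .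
  have f: "f \<in> H_infty lam" by (rule H_infty_uniform_limit[OF F C lim])
  have "converges_in_H_infty lam (\<lambda>k s. F (r k) (of_real \<sigma> + s)) (\<lambda>s. f (of_real \<sigma> + s))" if "\<sigma> > 0" for \<sigma>
    unfolding converges_in_H_infty_def
    using H_infty_translate[OF F that] H_infty_translate[OF f that] H_infty_norm_tendsto_0[OF lim[OF that]]
    by blast
  then show ?thesis using r(1) f by blast
qed

end
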